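(* Let $(M,\lambda_{(i)}(x,y))$ be a GAP-space equipped with a non-linear connection $N^\alpha_\mu$, and let $|$, $||$ be the $h$- and $v$-covariant derivatives of its canonical $d$-connection. Let $\widetilde R_{\mu\sigma}:=\widetilde R^\alpha_{\mu\sigma\alpha}$, $\widehat R_{\mu\sigma}:=\widehat R^\alpha_{\mu\sigma\alpha}$, $\mathring R_{\mu\sigma}:=\mathring R^\alpha_{\mu\sigma\alpha}$ and $\widetilde S_{\mu\sigma}:=\widetilde S^\alpha_{\mu\sigma\alpha}$, $\widehat S_{\mu\sigma}:=\widehat S^\alpha_{\mu\sigma\alpha}$, $\mathring S_{\mu\sigma}:=\mathring S^\alpha_{\mu\sigma\alpha}$ be the contractions of the $h$- and $v$-curvature tensors of the dual, symmetric and Riemannian $d$-connections. Then (a) $\widetilde R_{\mu\sigma}=\beta_{\sigma|\mu}+C^\alpha_{\epsilon\mu}R^\epsilon_{\sigma\alpha}+L^\alpha_{\sigma\alpha\mu}+L^\alpha_{\alpha\mu\sigma}$; (b) $\widetilde S_{\mu\sigma}=B_{\sigma||\mu}$; (c) $\widehat R_{\mu\sigma}=\tfrac12\widetilde R_{\mu\sigma}+\tfrac14\{\beta_\epsilon\Lambda^\epsilon_{\sigma\mu}+\Lambda^\epsilon_{\alpha\sigma}\Lambda^\alpha_{\mu\epsilon}\}$; (d) $\widehat S_{\mu\sigma}=\tfrac12\widetilde S_{\mu\sigma}+\tfrac14\{B_\epsilon T^\epsilon_{\sigma\mu}+T^\epsilon_{\alpha\sigma}T^\alpha_{\mu\epsilon}\}$;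 (e) $\mathring R_{\mu\sigma}=\beta_{\mu|\sigma}-\gamma^\alpha_{\mu\sigma|\alpha}+\beta_\epsilon\gamma^\epsilon_{\mu\sigma}-\gamma^\alpha_{\mu\epsilon}\gamma^\epsilon_{\sigma\alpha}+G^\alpha_{\mu\epsilon}R^\epsilon_{\alpha\sigma}$; (f) $\mathring S_{\mu\sigma}=B_{\mu||\sigma}-G^\alpha_{\mu\sigma||\alpha}+B_\epsilon G^\epsilon_{\mu\sigma}-G^\alpha_{\mu\epsilon}G^\epsilon_{\sigma\alpha}$.
   Context: $M$ is a $C^\infty$ manifold of dimension $n$, $\pi:TM\to M$ its tangent bundle with induced local coordinates $(x^\mu,y^\mu)$; $\partial_\mu=\partial/\partial x^\mu$, $\dot\partial_\mu=\partial/\partial y^\mu$. All objects are smooth in $(x,y)$. Summation convention on repeated Greek and repeated Latin indices. A non-linear connection is a system of functions $N^\alpha_\beta(x,y)$ on induced charts of $TM$ transforming by $N^{\alpha'}_{\beta'}=p^{\alpha'}_{\alpha}p^{\beta}_{\beta'}N^\alpha_\beta+p^{\alpha'}_{\epsilon}p^{\epsilon}_{\beta'\sigma'}y^{\sigma'}$, where $p^{\alpha'}_{\alpha}=\partial x^{\alpha'}/\partial x^{\alpha}$, $p^{\epsilon}_{\beta'\sigma'}=\partial^2x^\epsilon/\partial x^{\beta'}\partial x^{\sigma'}$; set $\delta_\mu=\partial_\mu-N^\alpha_\mu\dot\partial_\alpha$ and $R^\alpha_{\sigma\mu}:=\delta_\mu N^\alpha_\sigma-\delta_\sigma N^\alpha_\mu$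 (curvature of $N$). A GAP-space is a manifold $M$ together with $n$ global linearly independent sections $\lambda_{(i)}=(\lambda_{(i)}^\alpha(x,y))$ of the pullback bundle $\pi^{-1}(TM)$; $(\lambda_{(i)\alpha})$ is the inverse matrix ($\lambda_{(i)}^\alpha\lambda_{(i)\beta}=\delta^\alpha_\beta$, $\lambda_{(i)}^\alpha\lambda_{(j)\alpha}=\delta_{ij}$), and $g_{\mu\nu}=\lambda_{(i)\mu}\lambda_{(i)\nu}$ its metric, with inverse $g^{\mu\nu}$. $d$-connections (all with the same $N$): - canonical $D=(N,\Gamma,C)$: $\Gamma^\alpha_{\mu\nu}=\lambda_{(i)}^\alpha\delta_\nu\lambda_{(i)\mu}$, $C^\alpha_{\mu\nu}=\lambda_{(i)}^\alpha\dot\partial_\nu\lambda_{(i)\mu}$; - Riemannian $\mathring D=(N,\mathring\Gamma,\mathring C)$: $\mathring\Gamma^\alpha_{\mu\nu}=\tfrac12g^{\alpha\epsilon}(\delta_\mu g_{\nu\epsilon}+\delta_\nu g_{\mu\epsilon}-\delta_\epsilon g_{\mu\nu})$, $\mathring C^\alpha_{\mu\nu}=\tfrac12g^{\alpha\epsilon}(\dot\partial_\mu g_{\nu\epsilon}+\dot\partial_\nu g_{\mu\epsilon}-\dot\partial_\epsilon g_{\mu\nu})$; - dual $\widetilde D=(N,\widetilde\Gamma,\widetilde C)$: $\widetilde\Gamma^\alpha_{\mu\nu}=\Gamma^\alpha_{\nu\mu}$, $\widetilde C^\alpha_{\mu\nu}=C^\alpha_{\nu\mu}$; - symmetric $\widehat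 D=(N,\widehat\Gamma,\widehat C)$: $\widehat\Gamma^\alpha_{\mu\nu}=\tfrac12(\Gamma^\alpha_{\mu\nu}+\Gamma^\alpha_{\nu\mu})$, $\widehat C^\alpha_{\mu\nu}=\tfrac12(C^\alpha_{\mu\nu}+C^\alpha_{\nu\mu})$. For a $d$-connection $(N,\Gamma,C)$ the $h$- and $v$-covariant derivatives are $A^\alpha_{\mu|\nu}=\delta_\nu A^\alpha_\mu+A^\epsilon_\mu\Gamma^\alpha_{\epsilon\nu}-A^\alpha_\epsilon\Gamma^\epsilon_{\mu\nu}$, $A^\alpha_{\mu||\nu}=\dot\partial_\nu A^\alpha_\mu+A^\epsilon_\mu C^\alpha_{\epsilon\nu}-A^\alpha_\epsilon C^\epsilon_{\mu\nu}$ (similarly for other tensor types), and its $h$- and $v$-curvature tensors are $$R^\alpha_{\nu\mu\sigma}=\delta_\sigma\Gamma^\alpha_{\nu\mu}-\delta_\mu\Gamma^\alpha_{\nu\sigma}+\Gamma^\epsilon_{\nu\mu}\Gamma^\alpha_{\epsilon\sigma}-\Gamma^\epsilon_{\nu\sigma}\Gamma^\alpha_{\epsilon\mu}+C^\alpha_{\nu\epsilon}R^\epsilon_{\mu\sigma},$$ $$S^\alpha_{\nu\mu\sigma}=\dot\partial_\sigma C^\alpha_{\nu\mu}-\dot\partial_\mu C^\alpha_{\nu\sigma}+C^\epsilon_{\nu\mu}C^\alpha_{\epsilon\sigma}-C^\epsilon_{\nu\sigma}C^\alpha_{\epsilon\mu}.$$ The curvature tensors of $\widetilde D,\widehat D,\mathring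 D$ are obtained by using their own coefficients and carry the corresponding decoration. Tensors of the canonical $d$-connection: $\Lambda^\alpha_{\mu\nu}=\Gamma^\alpha_{\mu\nu}-\Gamma^\alpha_{\nu\mu}$, $T^\alpha_{\mu\nu}=C^\alpha_{\mu\nu}-C^\alpha_{\nu\mu}$, $\gamma^\alpha_{\mu\nu}=\Gamma^\alpha_{\mu\nu}-\mathring\Gamma^\alpha_{\mu\nu}$, $G^\alpha_{\mu\nu}=C^\alpha_{\mu\nu}-\mathring C^\alpha_{\mu\nu}$, $\beta_\mu=\Lambda^\epsilon_{\mu\epsilon}=\gamma^\epsilon_{\mu\epsilon}$, $B_\mu=T^\epsilon_{\mu\epsilon}=G^\epsilon_{\mu\epsilon}$, $L^\alpha_{\nu\mu\sigma}=C^\alpha_{\nu\epsilon}R^\epsilon_{\mu\sigma}$. *)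

theory Defs
  imports "HOL-Analysis.Analysis"
begin

section \<open>Smooth functions on open sets\<close>

text \<open>Intended for open \<open>S\<close>: \<open>f\<close> is of class $C^k$ when all partial derivatives of order
  at most \<open>k\<close> exist as total derivatives and are continuous.\<close>

primrec Ck_on :: "nat \<Rightarrow> ('a::euclidean_space \<Rightarrow> 'b::real_normed_vector) \<Rightarrow> 'a set \<Rightarrow> bool" where
  "Ck_on 0 f S \<longleftrightarrow> continuous_on S f"
| "Ck_on (Suc k) f S \<longleftrightarrow>
     f differentiable_on S \<and> (\<forall>b\<in>Basis. Ck_on k (\<lambda>x. frechet_derivative f (at x) b) S)"

definition smooth_on :: "('a::euclidean_space \<Rightarrow> 'b::real_normed_vector) \<Rightarrow> 'a set \<Rightarrow> bool" where
  "smooth_on f S \<longleftrightarrow> (\<forall>k. Ck_on k f S)"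


section \<open>Manifolds and induced coordinates on the tangent bundle\<close>

text \<open>A chart is a pair of its domain in the manifold and its coordinate map. The dimension is
  \<open>CARD('n)\<close>, and Greek indices are elements of \<open>'n\<close>.\<close>

type_synonym ('m, 'n) chart = "'m set \<times> ('m \<Rightarrow> (real, 'n) vec)"

definition coord_range :: "('m, 'n::finite) chart \<Rightarrow> (real^'n) set" where
  "coord_range a = snd a ` fst a"

definition is_chart :: "'m topology \<Rightarrow> ('m, 'n::finite) chart \<Rightarrow> bool" where
  "is_chart X a \<longleftrightarrow> openin X (fst a) \<and> open (coord_range a) \<and>
     homeomorphic_map (subtopology X (fst a)) (top_of_set (coord_range a)) (snd a)"

text \<open>The change of coordinates from \<open>a\<close> to \<open>b\<close>, and its domain in the coordinates of \<open>a\<close>.\<close>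

definition transition :: "('m, 'n::finite) chart \<Rightarrow> ('m, 'n) chart \<Rightarrow> real^'n \<Rightarrow> real^'n" where
  "transition a b x = snd b (inv_into (fst a) (snd a) x)"

definition overlap :: "('m, 'n::finite) chart \<Rightarrow> ('m, 'n) chart \<Rightarrow> (real^'n) set" where
  "overlap a b = snd a ` (fst a \<inter> fst b)"

text \<open>The atlas \<open>A\<close> need not be maximal; it determines the smooth structure.\<close>

definition smooth_manifold :: "'m topology \<Rightarrow> ('m, 'n::finite) chart set \<Rightarrow> bool" where
  "smooth_manifold X A \<longleftrightarrow>
     Hausdorff_space X \<and> second_countable X \<and>
     (\<forall>a\<in>A. is_chart X a) \<and> (\<Union>a\<in>A. fst a) = topspace X \<and>
     (\<forall>a\<in>A. \<forall>b\<in>A. smooth_on (transition a b) (overlap a b))"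

text \<open>A point $(x,y)$ in the induced coordinates of the tangent bundle: \<open>x\<close> is the position and
  \<open>y\<close> the fibre coordinate. A field is a real function of $(x,y)$; only its values on the range
  of the induced chart are meaningful.\<close>

type_synonym 'n point = "(real, 'n) vec \<times> (real, 'n) vec"
type_synonym 'n field = "'n point \<Rightarrow> real"

definition tm_range :: "('m, 'n::finite) chart \<Rightarrow> 'n point set" where
  "tm_range a = coord_range a \<times> UNIV"

definition pd :: "'n \<Rightarrow> (real^'n::finite \<Rightarrow> real) \<Rightarrow> real^'n \<Rightarrow> real" where
  "pd \<mu> f x = frechet_derivative f (at x) (axis \<mu> 1)"

text \<open>With unprimed coordinates from \<open>a\<close> and primed ones from \<open>b\<close>:
  \<open>jac a b \<alpha>' \<alpha>\<close> is $\partial x^{\alpha'}/\partial x^\alpha$ as a function of the coordinates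
  of \<open>a\<close>, and \<open>hess b a \<epsilon> \<beta>' \<sigma>'\<close> is
  $\partial^2 x^\epsilon/\partial x^{\beta'}\partial x^{\sigma'}$ as a function of those of \<open>b\<close>.\<close>

definition jac :: "('m, 'n::finite) chart \<Rightarrow> ('m, 'n) chart \<Rightarrow> 'n \<Rightarrow> 'n \<Rightarrow> real^'n \<Rightarrow> real" where
  "jac a b \<alpha>' \<alpha> = pd \<alpha> (\<lambda>x. transition a b x $ \<alpha>')"

definition hess :: "('m, 'n::finite) chart \<Rightarrow> ('m, 'n) chart \<Rightarrow> 'n \<Rightarrow> 'n \<Rightarrow> 'n \<Rightarrow> real^'n \<Rightarrow> real" where
  "hess b a \<epsilon> \<beta>' \<sigma>' = pd \<beta>' (pd \<sigma>' (\<lambda>x'. transition b a x' $ \<epsilon>))"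

definition tm_transition :: "('m, 'n::finite) chart \<Rightarrow> ('m, 'n) chart \<Rightarrow> 'n point \<Rightarrow> 'n point" where
  "tm_transition a b z =
     (transition a b (fst z), \<chi> \<alpha>'. \<Sum>\<alpha>\<in>UNIV. jac a b \<alpha>' \<alpha> (fst z) * snd z $ \<alpha>)"


section \<open>Non-linear connections and GAP-spaces\<close>

text \<open>\<open>N a \<alpha> \<beta>\<close> is $N^\alpha_\beta$ in the induced chart of \<open>a\<close>.\<close>

definition nonlinear_connection ::
    "('m, 'n::finite) chart set \<Rightarrow> (('m, 'n) chart \<Rightarrow> 'n \<Rightarrow> 'n \<Rightarrow> 'n field) \<Rightarrow> bool" where
  "nonlinear_connection A N \<longleftrightarrow>
     (\<forall>a\<in>A. \<forall>\<alpha> \<beta>. smooth_on (N a \<alpha> \<beta>) (tm_range a)) \<and>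
     (\<forall>a\<in>A. \<forall>b\<in>A. \<forall>x\<in>overlap a b. \<forall>y \<alpha>' \<beta>'.
        (let z' = tm_transition a b (x, y); x' = fst z'; y' = snd z' in
         N b \<alpha>' \<beta>' z' =
           (\<Sum>\<alpha>\<in>UNIV. \<Sum>\<beta>\<in>UNIV. jac a b \<alpha>' \<alpha> x * jac b a \<beta> \<beta>' x' * N a \<alpha> \<beta> (x, y))
         + (\<Sum>\<epsilon>\<in>UNIV. \<Sum>\<sigma>'\<in>UNIV. jac a b \<alpha>' \<epsilon> x * hess b a \<epsilon> \<beta>' \<sigma>' x' * y' $ \<sigma>')))"

text \<open>A smooth section of the pullback of the tangent bundle along its own projection, given by
  its components \<open>s a \<alpha>\<close> in each induced chart, which transform as those of a vector.\<close>

definition pullback_section ::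
    "('m, 'n::finite) chart set \<Rightarrow> (('m, 'n) chart \<Rightarrow> 'n \<Rightarrow> 'n field) \<Rightarrow> bool" where
  "pullback_section A s \<longleftrightarrow>
     (\<forall>a\<in>A. \<forall>\<alpha>. smooth_on (s a \<alpha>) (tm_range a)) \<and>
     (\<forall>a\<in>A. \<forall>b\<in>A. \<forall>x\<in>overlap a b. \<forall>y \<alpha>'.
        s b \<alpha>' (tm_transition a b (x, y)) = (\<Sum>\<alpha>\<in>UNIV. jac a b \<alpha>' \<alpha> x * s a \<alpha> (x, y)))"

text \<open>\<open>lam a i \<alpha>\<close> is $\lambda_{(i)}^\alpha$ in the induced chart of \<open>a\<close>. The Latin index
  also ranges over \<open>'n\<close>, so there are as many sections as the dimension.\<close>

definition gap_space ::
    "'m topology \<Rightarrow> ('m, 'n::finite) chart set \<Rightarrow> (('m, 'n) chart \<Rightarrow> 'n \<Rightarrow> 'n \<Rightarrow> 'n field) \<Rightarrow> bool"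
    where
  "gap_space X A lam \<longleftrightarrow>
     smooth_manifold X A \<and>
     (\<forall>i. pullback_section A (\<lambda>a. lam a i)) \<and>
     (\<forall>a\<in>A. \<forall>z\<in>tm_range a. \<forall>c :: 'n \<Rightarrow> real.
        (\<forall>\<alpha>. (\<Sum>i\<in>UNIV. c i * lam a i \<alpha> z) = 0) \<longrightarrow> (\<forall>i. c i = 0))"


section \<open>Local tensor calculus\<close>

text \<open>From here on everything lives in a single induced chart: \<open>N\<close> and \<open>lam\<close> are the components
  in that chart. Upper indices come first, then lower indices in order, so \<open>K \<alpha> \<nu> \<mu> \<sigma>\<close>
  is $K^\alpha_{\nu\mu\sigma}$.\<close>

definition dx :: "'n::finite \<Rightarrow> 'n field \<Rightarrow> 'n field" where
  "dx \<mu> f z = frechet_derivative f (at z) (axis \<mu> 1, 0)"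

definition dy :: "'n::finite \<Rightarrow> 'n field \<Rightarrow> 'n field" where
  "dy \<mu> f z = frechet_derivative f (at z) (0, axis \<mu> 1)"

definition delta :: "('n \<Rightarrow> 'n \<Rightarrow> 'n field) \<Rightarrow> 'n::finite \<Rightarrow> 'n field \<Rightarrow> 'n field" where
  "delta N \<mu> f z = dx \<mu> f z - (\<Sum>\<alpha>\<in>UNIV. N \<alpha> \<mu> z * dy \<alpha> f z)"

definition nl_curvature :: "('n \<Rightarrow> 'n \<Rightarrow> 'n field) \<Rightarrow> 'n::finite \<Rightarrow> 'n \<Rightarrow> 'n \<Rightarrow> 'n field" where
  "nl_curvature N \<alpha> \<sigma> \<mu> z = delta N \<mu> (N \<alpha> \<sigma>) z - delta N \<sigma> (N \<alpha> \<mu>) z"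

text \<open>\<open>colam lam i \<mu>\<close> is $\lambda_{(i)\mu}$. In the matrix of the frame the row index is Latin,
  hence in its inverse the row index is Greek.\<close>

definition colam :: "('n \<Rightarrow> 'n \<Rightarrow> 'n field) \<Rightarrow> 'n::finite \<Rightarrow> 'n \<Rightarrow> 'n field" where
  "colam lam i \<mu> z = matrix_inv (\<chi> j \<alpha>. lam j \<alpha> z) $ \<mu> $ i"

definition metric :: "('n \<Rightarrow> 'n \<Rightarrow> 'n field) \<Rightarrow> 'n::finite \<Rightarrow> 'n \<Rightarrow> 'n field" where
  "metric lam \<mu> \<nu> z = (\<Sum>i\<in>UNIV. colam lam i \<mu> z * colam lam i \<nu> z)"

definition metric_inv :: "('n \<Rightarrow> 'n \<Rightarrow> 'n field) \<Rightarrow> 'n::finite \<Rightarrow> 'n \<Rightarrow> 'n field" where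
  "metric_inv lam \<mu> \<nu> z = matrix_inv (\<chi> \<alpha> \<beta>. metric lam \<alpha> \<beta> z) $ \<mu> $ \<nu>"

text \<open>The coefficients of the d-connections. The suffix \<open>_h\<close> marks the horizontal coefficients
  ($\Gamma$) and \<open>_v\<close> the vertical ones ($C$).\<close>

definition canonical_h ::
    "('n \<Rightarrow> 'n \<Rightarrow> 'n field) \<Rightarrow> ('n \<Rightarrow> 'n \<Rightarrow> 'n field) \<Rightarrow> 'n::finite \<Rightarrow> 'n \<Rightarrow> 'n \<Rightarrow> 'n field" where
  "canonical_h N lam \<alpha> \<mu> \<nu> z = (\<Sum>i\<in>UNIV. lam i \<alpha> z * delta N \<nu> (colam lam i \<mu>) z)"

definition canonical_v :: "('n \<Rightarrow> 'n \<Rightarrow> 'n field) \<Rightarrow> 'n::finite \<Rightarrow> 'n \<Rightarrow> 'n \<Rightarrow> 'n field" where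
  "canonical_v lam \<alpha> \<mu> \<nu> z = (\<Sum>i\<in>UNIV. lam i \<alpha> z * dy \<nu> (colam lam i \<mu>) z)"

definition riemannian_h ::
    "('n \<Rightarrow> 'n \<Rightarrow> 'n field) \<Rightarrow> ('n \<Rightarrow> 'n \<Rightarrow> 'n field) \<Rightarrow> 'n::finite \<Rightarrow> 'n \<Rightarrow> 'n \<Rightarrow> 'n field" where
  "riemannian_h N lam \<alpha> \<mu> \<nu> z =
     1/2 * (\<Sum>\<epsilon>\<in>UNIV. metric_inv lam \<alpha> \<epsilon> z *
       (delta N \<mu> (metric lam \<nu> \<epsilon>) z + delta N \<nu> (metric lam \<mu> \<epsilon>) z - delta N \<epsilon> (metric lam \<mu> \<nu>) z))"

definition riemannian_v :: "('n \<Rightarrow> 'n \<Rightarrow> 'n field) \<Rightarrow> 'n::finite \<Rightarrow> 'n \<Rightarrow> 'n \<Rightarrow> 'n field" where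
  "riemannian_v lam \<alpha> \<mu> \<nu> z =
     1/2 * (\<Sum>\<epsilon>\<in>UNIV. metric_inv lam \<alpha> \<epsilon> z *
       (dy \<mu> (metric lam \<nu> \<epsilon>) z + dy \<nu> (metric lam \<mu> \<epsilon>) z - dy \<epsilon> (metric lam \<mu> \<nu>) z))"

text \<open>The next operations apply to the horizontal and to the vertical coefficients alike.\<close>

definition dual_coeff :: "('n \<Rightarrow> 'n \<Rightarrow> 'n \<Rightarrow> 'n field) \<Rightarrow> 'n \<Rightarrow> 'n \<Rightarrow> 'n \<Rightarrow> 'n field" where
  "dual_coeff \<Gamma> \<alpha> \<mu> \<nu> z = \<Gamma> \<alpha> \<nu> \<mu> z"

definition sym_coeff :: "('n \<Rightarrow> 'n \<Rightarrow> 'n \<Rightarrow> 'n field) \<Rightarrow> 'n \<Rightarrow> 'n \<Rightarrow> 'n \<Rightarrow> 'n field" where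
  "sym_coeff \<Gamma> \<alpha> \<mu> \<nu> z = 1/2 * (\<Gamma> \<alpha> \<mu> \<nu> z + \<Gamma> \<alpha> \<nu> \<mu> z)"

definition torsion :: "('n \<Rightarrow> 'n \<Rightarrow> 'n \<Rightarrow> 'n field) \<Rightarrow> 'n \<Rightarrow> 'n \<Rightarrow> 'n \<Rightarrow> 'n field" where
  "torsion \<Gamma> \<alpha> \<mu> \<nu> z = \<Gamma> \<alpha> \<mu> \<nu> z - \<Gamma> \<alpha> \<nu> \<mu> z"

definition contortion ::
    "('n \<Rightarrow> 'n \<Rightarrow> 'n \<Rightarrow> 'n field) \<Rightarrow> ('n \<Rightarrow> 'n \<Rightarrow> 'n \<Rightarrow> 'n field) \<Rightarrow> 'n \<Rightarrow> 'n \<Rightarrow> 'n \<Rightarrow> 'n field" where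
  "contortion \<Gamma> \<Gamma>0 \<alpha> \<mu> \<nu> z = \<Gamma> \<alpha> \<mu> \<nu> z - \<Gamma>0 \<alpha> \<mu> \<nu> z"

definition contracted_torsion ::
    "('n \<Rightarrow> 'n \<Rightarrow> 'n \<Rightarrow> 'n field) \<Rightarrow> 'n::finite \<Rightarrow> 'n field" where
  "contracted_torsion \<Lambda> \<mu> z = (\<Sum>\<epsilon>\<in>UNIV. \<Lambda> \<epsilon> \<mu> \<epsilon> z)"

definition L_tensor ::
    "('n \<Rightarrow> 'n \<Rightarrow> 'n field) \<Rightarrow> ('n \<Rightarrow> 'n \<Rightarrow> 'n \<Rightarrow> 'n field) \<Rightarrow>
     'n::finite \<Rightarrow> 'n \<Rightarrow> 'n \<Rightarrow> 'n \<Rightarrow> 'n field" where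
  "L_tensor N C \<alpha> \<nu> \<mu> \<sigma> z = (\<Sum>\<epsilon>\<in>UNIV. C \<alpha> \<nu> \<epsilon> z * nl_curvature N \<epsilon> \<mu> \<sigma> z)"

definition h_curvature ::
    "('n \<Rightarrow> 'n \<Rightarrow> 'n field) \<Rightarrow> ('n \<Rightarrow> 'n \<Rightarrow> 'n \<Rightarrow> 'n field) \<Rightarrow> ('n \<Rightarrow> 'n \<Rightarrow> 'n \<Rightarrow> 'n field) \<Rightarrow>
     'n::finite \<Rightarrow> 'n \<Rightarrow> 'n \<Rightarrow> 'n \<Rightarrow> 'n field" where
  "h_curvature N \<Gamma> C \<alpha> \<nu> \<mu> \<sigma> z =
     delta N \<sigma> (\<Gamma> \<alpha> \<nu> \<mu>) z - delta N \<mu> (\<Gamma> \<alpha> \<nu> \<sigma>) z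
     + (\<Sum>\<epsilon>\<in>UNIV. \<Gamma> \<epsilon> \<nu> \<mu> z * \<Gamma> \<alpha> \<epsilon> \<sigma> z)
     - (\<Sum>\<epsilon>\<in>UNIV. \<Gamma> \<epsilon> \<nu> \<sigma> z * \<Gamma> \<alpha> \<epsilon> \<mu> z)
     + (\<Sum>\<epsilon>\<in>UNIV. C \<alpha> \<nu> \<epsilon> z * nl_curvature N \<epsilon> \<mu> \<sigma> z)"

definition v_curvature ::
    "('n \<Rightarrow> 'n \<Rightarrow> 'n \<Rightarrow> 'n field) \<Rightarrow> 'n::finite \<Rightarrow> 'n \<Rightarrow> 'n \<Rightarrow> 'n \<Rightarrow> 'n field" where
  "v_curvature C \<alpha> \<nu> \<mu> \<sigma> z =
     dy \<sigma> (C \<alpha> \<nu> \<mu>) z - dy \<mu> (C \<alpha> \<nu> \<sigma>) z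
     + (\<Sum>\<epsilon>\<in>UNIV. C \<epsilon> \<nu> \<mu> z * C \<alpha> \<epsilon> \<sigma> z)
     - (\<Sum>\<epsilon>\<in>UNIV. C \<epsilon> \<nu> \<sigma> z * C \<alpha> \<epsilon> \<mu> z)"

text \<open>The contraction $K_{\mu\sigma} = K^\alpha_{\mu\sigma\alpha}$.\<close>

definition ricci :: "('n \<Rightarrow> 'n \<Rightarrow> 'n \<Rightarrow> 'n \<Rightarrow> 'n field) \<Rightarrow> 'n::finite \<Rightarrow> 'n \<Rightarrow> 'n field" where
  "ricci K \<mu> \<sigma> z = (\<Sum>\<alpha>\<in>UNIV. K \<alpha> \<mu> \<sigma> \<alpha> z)"

text \<open>Covariant derivatives of tensors of type (0,1) and (1,2); the last index is the one of
  differentiation. The parameter \<open>d\<close> is \<open>delta N\<close> for the horizontal derivative, taken with the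
  horizontal coefficients, and \<open>dy\<close> for the vertical one, taken with the vertical coefficients.\<close>

definition cov_01 ::
    "('n \<Rightarrow> 'n field \<Rightarrow> 'n field) \<Rightarrow> ('n \<Rightarrow> 'n \<Rightarrow> 'n \<Rightarrow> 'n field) \<Rightarrow>
     ('n \<Rightarrow> 'n field) \<Rightarrow> 'n::finite \<Rightarrow> 'n \<Rightarrow> 'n field" where
  "cov_01 d \<Gamma> A \<mu> \<nu> z = d \<nu> (A \<mu>) z - (\<Sum>\<epsilon>\<in>UNIV. A \<epsilon> z * \<Gamma> \<epsilon> \<mu> \<nu> z)"

definition cov_12 ::
    "('n \<Rightarrow> 'n field \<Rightarrow> 'n field) \<Rightarrow> ('n \<Rightarrow> 'n \<Rightarrow> 'n \<Rightarrow> 'n field) \<Rightarrow>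
     ('n \<Rightarrow> 'n \<Rightarrow> 'n \<Rightarrow> 'n field) \<Rightarrow> 'n::finite \<Rightarrow> 'n \<Rightarrow> 'n \<Rightarrow> 'n \<Rightarrow> 'n field" where
  "cov_12 d \<Gamma> A \<alpha> \<mu> \<sigma> \<nu> z =
     d \<nu> (A \<alpha> \<mu> \<sigma>) z
     + (\<Sum>\<epsilon>\<in>UNIV. A \<epsilon> \<mu> \<sigma> z * \<Gamma> \<alpha> \<epsilon> \<nu> z)
     - (\<Sum>\<epsilon>\<in>UNIV. A \<alpha> \<epsilon> \<sigma> z * \<Gamma> \<epsilon> \<mu> \<nu> z)
     - (\<Sum>\<epsilon>\<in>UNIV. A \<alpha> \<mu> \<epsilon> z * \<Gamma> \<epsilon> \<sigma> \<nu> z)"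

end

theory Submission
  imports Defs
begin

text \<open>The canonical connection makes the frame parallel, so both of its curvatures vanish. This
  turns every derivative in a contracted curvature of the dual, symmetric or Riemannian connection
  into derivatives of the torsion or contortion plus quadratic terms. The symmetric
  connection is the mean of the canonical and the dual one; since curvature is quadratic in the
  coefficients, its curvature differs from the mean of theirs by terms quadratic in the torsion.
  For the Riemannian connection one needs only its symmetry and
  $\mathring\Gamma^\epsilon_{\mu\epsilon} = \Gamma^\epsilon_{\epsilon\mu}$.\<close>

section \<open>Second derivatives\<close>

text \<open>Horizontal derivations do not commute: the commutator of two of them is the vertical
  operator R^\<epsilon>_{\<sigma>\<mu>} \<open>dy\<close> \<epsilon>. The C R term of the
  h-curvature absorbs exactly this, so flatness also holds for \<open>delta N\<close>, and the
  vertical coefficients enter the horizontal formulas. The six claims thus reduce to three about an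
  abstract \<open>d\<close> whose commutator is governed by an antisymmetric \<open>K\<close>. Given
  flatness, the derivatives of the coefficients may be treated as free families of reals, tied only
  by flatness (and, in the Riemannian case, by the symmetry and trace relations); each claim is then
  an identity of finite sums. The C R terms of the second connection involve vertical coefficients
  that \<open>d\<close> does not determine, so they are left out or carried as an arbitrary
  \<open>Q'\<close>, and filled in at the end. The analytic obstacle is the inverse frame: it comes
  from an inverse matrix chosen point by point, so its second derivatives must first be shown to
  exist and to commute.\<close>

lemma mixed_difference_quotient:
  fixes f :: "'a::real_normed_vector \<Rightarrow> real"
  assumes S: "open S" "z \<in> S" and f: "\<And>x. x \<in> S \<Longrightarrow> f differentiable (at x)"
    and u: "(\<lambda>x. frechet_derivative f (at x) u) differentiable (at z)"
  shows "((\<lambda>t. (f (z + t *\<^sub>R u + t *\<^sub>R v) - f (z + t *\<^sub>R u) - f (z + t *\<^sub>R v) + f z) / t\<^sup>2)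
    \<longlongrightarrow> frechet_derivative (\<lambda>x. frechet_derivative f (at x) u) (at z) v) (at_right 0)"
    (is "(?q \<longlongrightarrow> _) _")
proof (rule tendstoI)
  define D where "D = (\<lambda>x. frechet_derivative f (at x) u)"
  define L where "L = frechet_derivative D (at z)"
  have D: "(D has_derivative L) (at z)"
    using u unfolding D_def L_def by (simp add: frechet_derivative_works)
  then interpret L: bounded_linear L by (rule has_derivative_bounded_linear)
  fix e :: real
  assume e: "e > 0"
  \<comment> \<open>The error of linearising \<open>D\<close> at \<open>z\<close> is at most e/(2k)
    times the lengths of \<xi>u + tv and \<xi>u, which add up to at most t(2|u| + |v|). The summand
    1 keeps \<open>k\<close> positive for u = v = 0, and the factor 2 leaves e t / 2, strictly below
    e t.\<close>
  define k where "k = 2 * norm u + norm v + 1"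
  have k: "k > 0" by (simp add: k_def add_nonneg_pos)
  have "e / (2 * k) > 0" using e k by simp
  from D[unfolded has_derivative_at_alt] this obtain d1 where d1: "d1 > 0"
    "\<And>x. norm (x - z) < d1 \<Longrightarrow> norm (D x - D z - L (x - z)) \<le> e / (2 * k) * norm (x - z)"
    by blast
  obtain d2 where d2: "d2 > 0" "ball z d2 \<subseteq> S"
    using S open_contains_ball by blast
  define d where "d = min d1 d2"
  have d: "d > 0" "d \<le> d1" "d \<le> d2" using d1 d2 by (auto simp: d_def)
  have near: "dist (?q t) (L v) < e" if t: "0 < t" "t < d / k" for t
  proof -
    have tk: "t * k < d" using t k by (simp add: field_simps)
    have bd: "norm (s *\<^sub>R u) \<le> t * norm u" "norm (s *\<^sub>R u + t *\<^sub>R v) \<le> t * (norm u + norm v)"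
      if s: "0 \<le> s" "s \<le> t" for s
    proof -
      show a: "norm (s *\<^sub>R u) \<le> t * norm u"
        using s by (simp add: mult_right_mono)
      show "norm (s *\<^sub>R u + t *\<^sub>R v) \<le> t * (norm u + norm v)"
        using norm_triangle_ineq[of "s *\<^sub>R u" "t *\<^sub>R v"] a t by (simp add: algebra_simps)
    qed
    have "t * norm u < t * k" "t * (norm u + norm v) < t * k"
      using t norm_ge_zero[of u] norm_ge_zero[of v]
      by (auto simp: k_def add_nonneg_pos intro!: mult_strict_left_mono)
    then have small: "norm (s *\<^sub>R u) < d" "norm (s *\<^sub>R u + t *\<^sub>R v) < d" if "0 \<le> s" "s \<le> t" for s
      using bd[OF that] tk by linarith+
    have inS: "z + h \<in> S" if "norm h < d" for h
      using that d d2 by (auto simp: dist_norm subset_iff)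
    \<comment> \<open>The second difference is g(t) - g(0). The mean value theorem makes it t times
      a difference of two values of \<open>D\<close> near \<open>z\<close>, and the unknown \<xi>
      drops out of the linear part: L(\<xi>u + tv) - L(\<xi>u) = t L(v).\<close>
    define g where "g = (\<lambda>s. f (z + s *\<^sub>R u + t *\<^sub>R v) - f (z + s *\<^sub>R u))"
    \<comment> \<open>The offset \<open>w\<close> lets one statement serve both terms of
      \<open>g\<close>, with w = tv and w = 0.\<close>
    have line: "((\<lambda>s. f (z + s *\<^sub>R u + w)) has_real_derivative D (z + s *\<^sub>R u + w)) (at s)"
      if "z + s *\<^sub>R u + w \<in> S" for s w
    proof -
      have "(f has_derivative frechet_derivative f (at (z + s *\<^sub>R u + w))) (at (z + s *\<^sub>R u + w))"
        using f[OF that] by (simp add: frechet_derivative_works)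
      then have "((\<lambda>s. f (z + s *\<^sub>R u + w)) has_derivative
          (\<lambda>r. frechet_derivative f (at (z + s *\<^sub>R u + w)) (r *\<^sub>R u))) (at s)"
        by (rule has_derivative_compose[rotated]) (auto intro!: derivative_eq_intros)
      moreover have "(\<lambda>r. frechet_derivative f (at (z + s *\<^sub>R u + w)) (r *\<^sub>R u))
          = (*) (D (z + s *\<^sub>R u + w))"
        using linear_frechet_derivative[OF f[OF that]]
        by (auto simp: D_def linear_scale)
      ultimately show ?thesis by (simp add: has_field_derivative_def)
    qed
    have "(g has_real_derivative D (z + s *\<^sub>R u + t *\<^sub>R v) - D (z + s *\<^sub>R u)) (at s)"
      if "0 \<le> s" "s \<le> t" for s
    proof -
      have "z + s *\<^sub>R u + t *\<^sub>R v \<in> S" "z + s *\<^sub>R u + 0 \<in> S"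
        using inS[OF small(1)[OF that]] inS[OF small(2)[OF that]] by (simp_all add: add.assoc)
      from line[OF this(1)] line[OF this(2)] show ?thesis
        unfolding g_def by (auto intro!: derivative_eq_intros)
    qed
    from MVT2[OF t(1) this] obtain \<xi> where \<xi>: "0 < \<xi>" "\<xi> < t"
      and g: "g t - g 0 = t * (D (z + \<xi> *\<^sub>R u + t *\<^sub>R v) - D (z + \<xi> *\<^sub>R u))"
      by auto
    have b: "norm (D (z + h) - D z - L h) \<le> e / (2 * k) * norm h" if "norm h < d" for h
      using d1(2)[of "z + h"] that d by simp
    have "\<bar>D (z + \<xi> *\<^sub>R u + t *\<^sub>R v) - D (z + \<xi> *\<^sub>R u) - t * L v\<bar>
        \<le> e / (2 * k) * norm (\<xi> *\<^sub>R u + t *\<^sub>R v) + e / (2 * k) * norm (\<xi> *\<^sub>R u)"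
      using b[OF small(1), of \<xi>] b[OF small(2), of \<xi>] \<xi>
      by (simp add: L.add L.scaleR add.assoc)
    also have "\<dots> = e / (2 * k) * (norm (\<xi> *\<^sub>R u + t *\<^sub>R v) + norm (\<xi> *\<^sub>R u))"
      by (simp add: algebra_simps)
    also have "\<dots> \<le> e / (2 * k) * (t * k)"
      using bd[of \<xi>] \<xi> t e k by (intro mult_left_mono) (auto simp: k_def algebra_simps)
    also have "\<dots> < e * t" using k e t by simp
    finally have est: "\<bar>D (z + \<xi> *\<^sub>R u + t *\<^sub>R v) - D (z + \<xi> *\<^sub>R u) - t * L v\<bar> < e * t" .
    have "?q t = (g t - g 0) / t\<^sup>2" by (simp add: g_def)
    also have "\<dots> = (D (z + \<xi> *\<^sub>R u + t *\<^sub>R v) - D (z + \<xi> *\<^sub>R u)) / t"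
      unfolding g using t by (simp add: power2_eq_square)
    finally have q: "?q t - L v = (D (z + \<xi> *\<^sub>R u + t *\<^sub>R v) - D (z + \<xi> *\<^sub>R u) - t * L v) / t"
      using t by (simp add: diff_divide_distrib)
    show ?thesis
      unfolding dist_real_def q using est t by (simp add: abs_divide divide_less_eq)
  qed
  have "\<forall>\<^sub>F t in at_right 0. t \<in> {0<..<d / k}"
    by (rule eventually_at_right_real) (use d k in simp)
  then show "\<forall>\<^sub>F t in at_right 0.
      dist (?q t) (frechet_derivative (\<lambda>x. frechet_derivative f (at x) u) (at z) v) < e"
    by eventually_elim (use near in \<open>auto simp: L_def D_def\<close>)
qed

text \<open>The second difference quotient is symmetric in \<open>u\<close> and \<open>v\<close>, so
  both mixed derivatives are its limit as t tends to 0 from the right.\<close>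

lemma frechet_derivative_commute:
  fixes f :: "'a::real_normed_vector \<Rightarrow> real"
  assumes S: "open S" "z \<in> S" and f: "\<And>x. x \<in> S \<Longrightarrow> f differentiable (at x)"
    and u: "(\<lambda>x. frechet_derivative f (at x) u) differentiable (at z)"
    and v: "(\<lambda>x. frechet_derivative f (at x) v) differentiable (at z)"
  shows "frechet_derivative (\<lambda>x. frechet_derivative f (at x) u) (at z) v
       = frechet_derivative (\<lambda>x. frechet_derivative f (at x) v) (at z) u"
proof (rule tendsto_unique[OF trivial_limit_at_right_real])
  show "((\<lambda>t. (f (z + t *\<^sub>R u + t *\<^sub>R v) - f (z + t *\<^sub>R u) - f (z + t *\<^sub>R v) + f z) / t\<^sup>2)
    \<longlongrightarrow> frechet_derivative (\<lambda>x. frechet_derivative f (at x) u) (at z) v) (at_right 0)"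
    by (rule mixed_difference_quotient[OF S f u])
  show "((\<lambda>t. (f (z + t *\<^sub>R u + t *\<^sub>R v) - f (z + t *\<^sub>R u) - f (z + t *\<^sub>R v) + f z) / t\<^sup>2)
    \<longlongrightarrow> frechet_derivative (\<lambda>x. frechet_derivative f (at x) v) (at z) u) (at_right 0)"
    using mixed_difference_quotient[OF S f v, of u] by (simp add: algebra_simps)
qed

text \<open>Enough regularity for second partials to exist and commute, and stable under the field
  operations without an induction over the order of differentiation. The directions are those of
  \<open>Basis\<close>, as in \<open>Ck_on\<close>; the coordinate axes of x and y are among
  them.\<close>

definition twice_differentiable_on ::
    "('a::euclidean_space \<Rightarrow> real) \<Rightarrow> 'a set \<Rightarrow> bool" where
  "twice_differentiable_on f S \<longleftrightarrow> (\<forall>z\<in>S. f differentiable (at z)) \<and>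
     (\<forall>v\<in>Basis. \<forall>z\<in>S. (\<lambda>x. frechet_derivative f (at x) v) differentiable (at z))"

lemma differentiable_at_cong_open:
  assumes "open S" "z \<in> S" "\<And>x. x \<in> S \<Longrightarrow> f x = g x" "f differentiable (at z)"
  shows "g differentiable (at z)"
  using assms has_derivative_transform_within_open unfolding differentiable_def by blast

lemma smooth_imp_twice_differentiable_on:
  assumes "smooth_on f S" "open S"
  shows "twice_differentiable_on f S"
proof -
  have "Ck_on (Suc (Suc 0)) f S" using assms unfolding smooth_on_def by blast
  then show ?thesis using assms(2)
    by (simp add: twice_differentiable_on_def differentiable_on_eq_differentiable_at)
qed

section \<open>Stability of twice differentiability under algebraic operations and matrix
  inversion\<close>

lemma frechet_derivative_add_at:
  assumes "f differentiable (at z)" "g differentiable (at z)"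
  shows "frechet_derivative (\<lambda>x. f x + g x) (at z) v
    = frechet_derivative f (at z) v + frechet_derivative g (at z) v"
  using frechet_derivative_at[OF has_derivative_add[OF assms[unfolded frechet_derivative_works]]]
  by metis

lemma frechet_derivative_mult_at:
  fixes f g :: "'a::real_normed_vector \<Rightarrow> real"
  assumes "f differentiable (at z)" "g differentiable (at z)"
  shows "frechet_derivative (\<lambda>x. f x * g x) (at z) v
    = f z * frechet_derivative g (at z) v + frechet_derivative f (at z) v * g z"
  using frechet_derivative_at[OF has_derivative_mult[OF assms[unfolded frechet_derivative_works]]]
  by metis

lemma frechet_derivative_inverse_at:
  fixes f :: "'a::real_normed_vector \<Rightarrow> real"
  assumes "f differentiable (at z)" "f z \<noteq> 0"
  shows "frechet_derivative (\<lambda>x. inverse (f x)) (at z) v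
    = - (inverse (f z) * frechet_derivative f (at z) v * inverse (f z))"
  using frechet_derivative_at[OF Deriv.has_derivative_inverse[OF assms(2)
      assms(1)[unfolded frechet_derivative_works]]]
  by metis

context
  fixes S :: "'a::euclidean_space set"
  assumes S: "open S"
begin

text \<open>On an open set, equal functions have equal derivatives. This lets an explicit formula
  valid only on \<open>S\<close> stand in for an opaque one, as Cramer's rule does for
  \<open>matrix_inv\<close>.\<close>

lemma twice_differentiable_on_cong:
  assumes eq: "\<And>x. x \<in> S \<Longrightarrow> f x = g x" and f: "twice_differentiable_on f S"
  shows "twice_differentiable_on g S"
proof -
  have "frechet_derivative f (at x) v = frechet_derivative g (at x) v" if "x \<in> S" for x v
    using frechet_derivative_transform_within_open[OF _ S that eq] f that
    by (auto simp: twice_differentiable_on_def)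
  with f eq show ?thesis
    unfolding twice_differentiable_on_def
    by (metis (no_types, lifting) differentiable_at_cong_open[OF S])
qed

lemma twice_differentiable_on_const: "twice_differentiable_on (\<lambda>x. c) S"
  by (simp add: twice_differentiable_on_def)

text \<open>The formula for the derivative holds throughout the open \<open>S\<close>, so it can
  itself be differentiated; products and reciprocals follow the same pattern.\<close>

lemma twice_differentiable_on_add:
  assumes "twice_differentiable_on f S" "twice_differentiable_on g S"
  shows "twice_differentiable_on (\<lambda>x. f x + g x) S"
  unfolding twice_differentiable_on_def
proof safe
  fix v :: 'a and z assume v: "v \<in> Basis" and z: "z \<in> S"
  have "(\<lambda>x. frechet_derivative f (at x) v + frechet_derivative g (at x) v) differentiable (at z)"
    using assms v z by (auto simp: twice_differentiable_on_def)
  then show "(\<lambda>x. frechet_derivative (\<lambda>x. f x + g x) (at x) v) differentiable (at z)"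
    by (rule differentiable_at_cong_open[OF S z, rotated])
      (use assms in \<open>simp add: twice_differentiable_on_def frechet_derivative_add_at\<close>)
qed (use assms in \<open>auto simp: twice_differentiable_on_def\<close>)

lemma twice_differentiable_on_mult:
  assumes "twice_differentiable_on f S" "twice_differentiable_on g S"
  shows "twice_differentiable_on (\<lambda>x. f x * g x) S"
  unfolding twice_differentiable_on_def
proof safe
  fix v :: 'a and z assume v: "v \<in> Basis" and z: "z \<in> S"
  have "(\<lambda>x. f x * frechet_derivative g (at x) v + frechet_derivative f (at x) v * g x)
      differentiable (at z)"
    using assms v z by (auto simp: twice_differentiable_on_def)
  then show "(\<lambda>x. frechet_derivative (\<lambda>x. f x * g x) (at x) v) differentiable (at z)"
    by (rule differentiable_at_cong_open[OF S z, rotated])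
      (use assms in \<open>simp add: twice_differentiable_on_def frechet_derivative_mult_at\<close>)
qed (use assms in \<open>auto simp: twice_differentiable_on_def\<close>)

lemma twice_differentiable_on_inverse:
  assumes f: "twice_differentiable_on f S" and nz: "\<And>x. x \<in> S \<Longrightarrow> f x \<noteq> 0"
  shows "twice_differentiable_on (\<lambda>x. inverse (f x)) S"
  unfolding twice_differentiable_on_def
proof safe
  fix v :: 'a and z assume v: "v \<in> Basis" and z: "z \<in> S"
  have "(\<lambda>x. - (inverse (f x) * frechet_derivative f (at x) v * inverse (f x)))
      differentiable (at z)"
    using assms v z by (auto simp: twice_differentiable_on_def)
  then show "(\<lambda>x. frechet_derivative (\<lambda>x. inverse (f x)) (at x) v) differentiable (at z)"
    by (rule differentiable_at_cong_open[OF S z, rotated])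
      (use assms in \<open>simp add: twice_differentiable_on_def frechet_derivative_inverse_at\<close>)
qed (use assms in \<open>auto simp: twice_differentiable_on_def\<close>)

lemma twice_differentiable_on_sum:
  assumes "\<And>i. i \<in> I \<Longrightarrow> twice_differentiable_on (f i) S"
  shows "twice_differentiable_on (\<lambda>x. \<Sum>i\<in>I. f i x) S"
  using assms by (induction I rule: infinite_finite_induct)
    (auto intro: twice_differentiable_on_const twice_differentiable_on_add)

lemma twice_differentiable_on_prod:
  assumes "\<And>i. i \<in> I \<Longrightarrow> twice_differentiable_on (f i) S"
  shows "twice_differentiable_on (\<lambda>x. \<Prod>i\<in>I. f i x) S"
  using assms by (induction I rule: infinite_finite_induct)
    (auto intro: twice_differentiable_on_const twice_differentiable_on_mult)

lemma twice_differentiable_on_det: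
  fixes A :: "'a \<Rightarrow> real^'n^'n"
  assumes "\<And>i j. twice_differentiable_on (\<lambda>x. A x $ i $ j) S"
  shows "twice_differentiable_on (\<lambda>x. det (A x)) S"
  unfolding det_def
  by (intro twice_differentiable_on_sum twice_differentiable_on_mult twice_differentiable_on_const
      twice_differentiable_on_prod assms)

text \<open>By Cramer's rule each entry of the inverse is a quotient of determinants, that is, of
  polynomials in the entries, although \<open>matrix_inv\<close> is chosen separately at every
  point.\<close>

lemma twice_differentiable_on_matrix_inv:
  fixes A :: "'a \<Rightarrow> real^'n^'n"
  assumes A: "\<And>i j. twice_differentiable_on (\<lambda>x. A x $ i $ j) S"
    and inv: "\<And>x. x \<in> S \<Longrightarrow> invertible (A x)"
  shows "twice_differentiable_on (\<lambda>x. matrix_inv (A x) $ i $ j) S"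
proof (rule twice_differentiable_on_cong)
  \<comment> \<open>Column \<open>i\<close> of \<open>A x\<close> is replaced by the
    \<open>j\<close>-th unit vector: Cramer's rule for component \<open>i\<close> of the solution of
    the linear system whose solution is column \<open>j\<close> of the inverse.\<close>
  define B where "B = (\<lambda>x. (\<chi> k l. if l = i then axis j 1 $ k else A x $ k $ l) :: real^'n^'n)"
  show "det (B x) * inverse (det (A x)) = matrix_inv (A x) $ i $ j" if "x \<in> S" for x
  proof -
    have "A x *v (matrix_inv (A x) *v axis j 1) = axis j 1"
      using someI_ex[OF inv[OF that, unfolded invertible_def]]
      by (simp add: matrix_vector_mul_assoc matrix_inv_def)
    with inv[OF that] show ?thesis
      by (subst (asm) cramer)
        (simp_all add: invertible_det_nz vec_eq_iff B_def matrix_vector_mul_component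
          inner_axis divide_inverse)
  qed
  have "twice_differentiable_on (\<lambda>x. B x $ k $ l) S" for k l
    using A by (cases "l = i") (simp_all add: B_def twice_differentiable_on_const)
  then show "twice_differentiable_on (\<lambda>x. det (B x) * inverse (det (A x))) S"
    using inv A
    by (intro twice_differentiable_on_mult twice_differentiable_on_inverse
        twice_differentiable_on_det) (auto simp: invertible_det_nz)
qed

end

section \<open>Algebra of the contracted curvatures\<close>

text \<open>Here \<open>P \<alpha> \<nu> \<mu> \<sigma>\<close> stands for the derivative of $\Gamma^\alpha_{\nu\mu}$ in direction
  \<open>\<sigma>\<close>, and \<open>Q\<close> for the term that the curvature of the non-linear connection contributes to the
  curvature of $\Gamma$; primes refer to the second connection.\<close>

lemma ricci_dual_identity:
  fixes \<Gamma> :: "'n::finite \<Rightarrow> 'n \<Rightarrow> 'n \<Rightarrow> real" and P Q :: "'n \<Rightarrow> 'n \<Rightarrow> 'n \<Rightarrow> 'n \<Rightarrow> real"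
  assumes flat: "\<And>\<alpha> \<nu> \<mu> \<sigma>. P \<alpha> \<nu> \<mu> \<sigma> - P \<alpha> \<nu> \<sigma> \<mu> + (\<Sum>\<epsilon>\<in>UNIV. \<Gamma> \<epsilon> \<nu> \<mu> * \<Gamma> \<alpha> \<epsilon> \<sigma>)
      - (\<Sum>\<epsilon>\<in>UNIV. \<Gamma> \<epsilon> \<nu> \<sigma> * \<Gamma> \<alpha> \<epsilon> \<mu>) + Q \<alpha> \<nu> \<mu> \<sigma> = 0"
    and antisym: "\<And>\<alpha> \<nu> \<mu> \<sigma>. Q \<alpha> \<nu> \<mu> \<sigma> = - Q \<alpha> \<nu> \<sigma> \<mu>"
  shows "(\<Sum>\<alpha>\<in>UNIV. P \<alpha> \<sigma> \<mu> \<alpha> - P \<alpha> \<alpha> \<mu> \<sigma> + (\<Sum>\<epsilon>\<in>UNIV. \<Gamma> \<epsilon> \<sigma> \<mu> * \<Gamma> \<alpha> \<alpha> \<epsilon>)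
        - (\<Sum>\<epsilon>\<in>UNIV. \<Gamma> \<epsilon> \<alpha> \<mu> * \<Gamma> \<alpha> \<sigma> \<epsilon>))
    = (\<Sum>\<alpha>\<in>UNIV. P \<alpha> \<sigma> \<alpha> \<mu> - P \<alpha> \<alpha> \<sigma> \<mu>)
      - (\<Sum>\<epsilon>\<in>UNIV. (\<Sum>\<alpha>\<in>UNIV. \<Gamma> \<alpha> \<epsilon> \<alpha> - \<Gamma> \<alpha> \<alpha> \<epsilon>) * \<Gamma> \<epsilon> \<sigma> \<mu>)
      + (\<Sum>\<alpha>\<in>UNIV. Q \<alpha> \<sigma> \<alpha> \<mu>) + (\<Sum>\<alpha>\<in>UNIV. Q \<alpha> \<alpha> \<mu> \<sigma>)"
proof -
  \<comment> \<open>Flatness contracted in its last index trades P^\<alpha>_{\<sigma>\<mu>\<alpha>}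
    for P^\<alpha>_{\<sigma>\<alpha>\<mu>}, the derivative that occurs in that of the contracted
    torsion. Antisymmetry puts \<open>Q\<close> into the order wanted.\<close>
  have 1: "(\<Sum>\<alpha>\<in>UNIV. P \<alpha> \<sigma> \<mu> \<alpha> - P \<alpha> \<sigma> \<alpha> \<mu> + (\<Sum>\<epsilon>\<in>UNIV. \<Gamma> \<epsilon> \<sigma> \<mu> * \<Gamma> \<alpha> \<epsilon> \<alpha>)
      - (\<Sum>\<epsilon>\<in>UNIV. \<Gamma> \<epsilon> \<sigma> \<alpha> * \<Gamma> \<alpha> \<epsilon> \<mu>) - Q \<alpha> \<sigma> \<alpha> \<mu>) = 0"
    using flat[of _ \<sigma> \<mu>] antisym[of _ \<sigma> \<mu>] by (intro sum.neutral) simp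
  \<comment> \<open>Contracting the first lower index instead makes the quadratic part the trace of
    a commutator of matrices, which vanishes by \<open>3\<close>; only the \<open>Q\<close> term is
    left.\<close>
  have 2: "(\<Sum>\<alpha>\<in>UNIV. P \<alpha> \<alpha> \<mu> \<sigma> - P \<alpha> \<alpha> \<sigma> \<mu> + (\<Sum>\<epsilon>\<in>UNIV. \<Gamma> \<epsilon> \<alpha> \<mu> * \<Gamma> \<alpha> \<epsilon> \<sigma>)
      - (\<Sum>\<epsilon>\<in>UNIV. \<Gamma> \<epsilon> \<alpha> \<sigma> * \<Gamma> \<alpha> \<epsilon> \<mu>) + Q \<alpha> \<alpha> \<mu> \<sigma>) = 0"
    using flat by (intro sum.neutral) simp
  have 3: "(\<Sum>\<alpha>\<in>UNIV. \<Sum>\<epsilon>\<in>UNIV. \<Gamma> \<epsilon> \<alpha> \<mu> * \<Gamma> \<alpha> \<epsilon> \<sigma>)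
      = (\<Sum>\<alpha>\<in>UNIV. \<Sum>\<epsilon>\<in>UNIV. \<Gamma> \<epsilon> \<alpha> \<sigma> * \<Gamma> \<alpha> \<epsilon> \<mu>)"
    by (subst sum.swap) (simp add: mult.commute)
  have 4: "(\<Sum>\<alpha>\<in>UNIV. \<Sum>\<epsilon>\<in>UNIV. \<Gamma> \<epsilon> \<sigma> \<alpha> * \<Gamma> \<alpha> \<epsilon> \<mu>)
      = (\<Sum>\<alpha>\<in>UNIV. \<Sum>\<epsilon>\<in>UNIV. \<Gamma> \<epsilon> \<alpha> \<mu> * \<Gamma> \<alpha> \<sigma> \<epsilon>)"
    by (subst sum.swap) (simp add: mult.commute)
  have 5: "(\<Sum>\<epsilon>\<in>UNIV. (\<Sum>\<alpha>\<in>UNIV. \<Gamma> \<alpha> \<epsilon> \<alpha> - \<Gamma> \<alpha> \<alpha> \<epsilon>) * \<Gamma> \<epsilon> \<sigma> \<mu>)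
      = (\<Sum>\<alpha>\<in>UNIV. \<Sum>\<epsilon>\<in>UNIV. \<Gamma> \<epsilon> \<sigma> \<mu> * \<Gamma> \<alpha> \<epsilon> \<alpha>)
        - (\<Sum>\<alpha>\<in>UNIV. \<Sum>\<epsilon>\<in>UNIV. \<Gamma> \<epsilon> \<sigma> \<mu> * \<Gamma> \<alpha> \<alpha> \<epsilon>)"
    unfolding sum_distrib_right
    by (subst sum.swap) (simp add: sum_subtractf algebra_simps)
  show ?thesis
    using 1 2 3 4 5 by (simp add: sum.distrib sum_subtractf)
qed

text \<open>Polarisation, (a + b)(c + d) = 2ac + 2bd - (a - b)(c - d), applied to \<Gamma> and its
  transpose gives the mean of the two curvatures and a torsion correction; flatness removes the
  canonical half. \<open>Q'\<close> can be arbitrary because half of it stands on both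
  sides.\<close>

lemma ricci_sym_identity:
  fixes \<Gamma> :: "'n::finite \<Rightarrow> 'n \<Rightarrow> 'n \<Rightarrow> real" and P Q Q' :: "'n \<Rightarrow> 'n \<Rightarrow> 'n \<Rightarrow> 'n \<Rightarrow> real"
  assumes flat: "\<And>\<alpha> \<nu> \<mu> \<sigma>. P \<alpha> \<nu> \<mu> \<sigma> - P \<alpha> \<nu> \<sigma> \<mu> + (\<Sum>\<epsilon>\<in>UNIV. \<Gamma> \<epsilon> \<nu> \<mu> * \<Gamma> \<alpha> \<epsilon> \<sigma>)
      - (\<Sum>\<epsilon>\<in>UNIV. \<Gamma> \<epsilon> \<nu> \<sigma> * \<Gamma> \<alpha> \<epsilon> \<mu>) + Q \<alpha> \<nu> \<mu> \<sigma> = 0"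
    and \<Delta>: "\<Delta> = (\<lambda>\<alpha> \<mu> \<nu>. 1/2 * (\<Gamma> \<alpha> \<mu> \<nu> + \<Gamma> \<alpha> \<nu> \<mu>))"
    and \<Lambda>: "\<Lambda> = (\<lambda>\<alpha> \<mu> \<nu>. \<Gamma> \<alpha> \<mu> \<nu> - \<Gamma> \<alpha> \<nu> \<mu>)"
  shows "(\<Sum>\<alpha>\<in>UNIV. 1/2 * (P \<alpha> \<mu> \<sigma> \<alpha> + P \<alpha> \<sigma> \<mu> \<alpha>) - 1/2 * (P \<alpha> \<mu> \<alpha> \<sigma> + P \<alpha> \<alpha> \<mu> \<sigma>)
        + (\<Sum>\<epsilon>\<in>UNIV. \<Delta> \<epsilon> \<mu> \<sigma> * \<Delta> \<alpha> \<epsilon> \<alpha>) - (\<Sum>\<epsilon>\<in>UNIV. \<Delta> \<epsilon> \<mu> \<alpha> * \<Delta> \<alpha> \<epsilon> \<sigma>)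
        + 1/2 * (Q \<alpha> \<mu> \<sigma> \<alpha> + Q' \<alpha> \<mu> \<sigma> \<alpha>))
    = 1/2 * (\<Sum>\<alpha>\<in>UNIV. P \<alpha> \<sigma> \<mu> \<alpha> - P \<alpha> \<alpha> \<mu> \<sigma> + (\<Sum>\<epsilon>\<in>UNIV. \<Gamma> \<epsilon> \<sigma> \<mu> * \<Gamma> \<alpha> \<alpha> \<epsilon>)
        - (\<Sum>\<epsilon>\<in>UNIV. \<Gamma> \<epsilon> \<alpha> \<mu> * \<Gamma> \<alpha> \<sigma> \<epsilon>) + Q' \<alpha> \<mu> \<sigma> \<alpha>)
      + 1/4 * ((\<Sum>\<epsilon>\<in>UNIV. (\<Sum>\<alpha>\<in>UNIV. \<Lambda> \<alpha> \<epsilon> \<alpha>) * \<Lambda> \<epsilon> \<sigma> \<mu>)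
             + (\<Sum>\<epsilon>\<in>UNIV. \<Sum>\<alpha>\<in>UNIV. \<Lambda> \<epsilon> \<alpha> \<sigma> * \<Lambda> \<alpha> \<mu> \<epsilon>))"
proof -
  have 1: "(\<Sum>\<alpha>\<in>UNIV. P \<alpha> \<mu> \<sigma> \<alpha> - P \<alpha> \<mu> \<alpha> \<sigma> + (\<Sum>\<epsilon>\<in>UNIV. \<Gamma> \<epsilon> \<mu> \<sigma> * \<Gamma> \<alpha> \<epsilon> \<alpha>)
      - (\<Sum>\<epsilon>\<in>UNIV. \<Gamma> \<epsilon> \<mu> \<alpha> * \<Gamma> \<alpha> \<epsilon> \<sigma>) + Q \<alpha> \<mu> \<sigma> \<alpha>) = 0"
    using flat by (intro sum.neutral) simp
  have 2: "(\<Sum>\<epsilon>\<in>UNIV. (\<Sum>\<alpha>\<in>UNIV. \<Lambda> \<alpha> \<epsilon> \<alpha>) * \<Lambda> \<epsilon> \<sigma> \<mu>)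
      = (\<Sum>\<alpha>\<in>UNIV. \<Sum>\<epsilon>\<in>UNIV. \<Lambda> \<epsilon> \<sigma> \<mu> * \<Lambda> \<alpha> \<epsilon> \<alpha>)"
    unfolding sum_distrib_right by (subst sum.swap) (simp add: mult.commute)
  \<comment> \<open>The correction is positive here and negative in \<open>4\<close>: here the first
    torsion factor is written with its lower indices interchanged, which absorbs the sign.\<close>
  have 3: "4 * (\<Sum>\<epsilon>\<in>UNIV. \<Delta> \<epsilon> \<mu> \<sigma> * \<Delta> \<alpha> \<epsilon> \<alpha>) = 2 * (\<Sum>\<epsilon>\<in>UNIV. \<Gamma> \<epsilon> \<mu> \<sigma> * \<Gamma> \<alpha> \<epsilon> \<alpha>)
      + 2 * (\<Sum>\<epsilon>\<in>UNIV. \<Gamma> \<epsilon> \<sigma> \<mu> * \<Gamma> \<alpha> \<alpha> \<epsilon>) + (\<Sum>\<epsilon>\<in>UNIV. \<Lambda> \<epsilon> \<sigma> \<mu> * \<Lambda> \<alpha> \<epsilon> \<alpha>)" for \<alpha>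
    unfolding sum_distrib_left sum.distrib[symmetric] \<Delta> \<Lambda>
    by (intro sum.cong) (auto simp: algebra_simps)
  have 4: "4 * (\<Sum>\<epsilon>\<in>UNIV. \<Delta> \<epsilon> \<mu> \<alpha> * \<Delta> \<alpha> \<epsilon> \<sigma>) = 2 * (\<Sum>\<epsilon>\<in>UNIV. \<Gamma> \<epsilon> \<mu> \<alpha> * \<Gamma> \<alpha> \<epsilon> \<sigma>)
      + 2 * (\<Sum>\<epsilon>\<in>UNIV. \<Gamma> \<epsilon> \<alpha> \<mu> * \<Gamma> \<alpha> \<sigma> \<epsilon>) - (\<Sum>\<epsilon>\<in>UNIV. \<Lambda> \<alpha> \<epsilon> \<sigma> * \<Lambda> \<epsilon> \<mu> \<alpha>)" for \<alpha>
    unfolding sum_distrib_left sum.distrib[symmetric] sum_subtractf[symmetric] \<Delta> \<Lambda>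
    by (intro sum.cong) (auto simp: algebra_simps)
  have 5: "(\<Sum>\<epsilon>\<in>UNIV. \<Delta> \<epsilon> \<mu> \<sigma> * \<Delta> \<alpha> \<epsilon> \<alpha>) = 1/2 * (\<Sum>\<epsilon>\<in>UNIV. \<Gamma> \<epsilon> \<mu> \<sigma> * \<Gamma> \<alpha> \<epsilon> \<alpha>)
      + 1/2 * (\<Sum>\<epsilon>\<in>UNIV. \<Gamma> \<epsilon> \<sigma> \<mu> * \<Gamma> \<alpha> \<alpha> \<epsilon>) + 1/4 * (\<Sum>\<epsilon>\<in>UNIV. \<Lambda> \<epsilon> \<sigma> \<mu> * \<Lambda> \<alpha> \<epsilon> \<alpha>)"
    "(\<Sum>\<epsilon>\<in>UNIV. \<Delta> \<epsilon> \<mu> \<alpha> * \<Delta> \<alpha> \<epsilon> \<sigma>) = 1/2 * (\<Sum>\<epsilon>\<in>UNIV. \<Gamma> \<epsilon> \<mu> \<alpha> * \<Gamma> \<alpha> \<epsilon> \<sigma>)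
      + 1/2 * (\<Sum>\<epsilon>\<in>UNIV. \<Gamma> \<epsilon> \<alpha> \<mu> * \<Gamma> \<alpha> \<sigma> \<epsilon>) - 1/4 * (\<Sum>\<epsilon>\<in>UNIV. \<Lambda> \<alpha> \<epsilon> \<sigma> * \<Lambda> \<epsilon> \<mu> \<alpha>)" for \<alpha>
    using 3[of \<alpha>] 4[of \<alpha>] by linarith+
  show ?thesis
    using 1 unfolding 2 5
    by (simp add: sum.distrib sum_subtractf sum_distrib_left[symmetric] sum_divide_distrib[symmetric]
        algebra_simps add_divide_distrib diff_divide_distrib)
qed

text \<open>After substituting \<Gamma>' = \<Gamma> - \<gamma>, the products linear in \<gamma> are
  the connection terms of the two covariant derivatives, and those quadratic in \<gamma> are the
  last two products. Here \<open>tr\<close> makes \<beta> the trace of \<gamma>, and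
  \<open>trP\<close> is the differentiated form of \<open>tr\<close>.\<close>

lemma ricci_symmetric_connection_identity:
  fixes \<Gamma> \<Gamma>' \<gamma> :: "'n::finite \<Rightarrow> 'n \<Rightarrow> 'n \<Rightarrow> real"
    and P P' Q Q' :: "'n \<Rightarrow> 'n \<Rightarrow> 'n \<Rightarrow> 'n \<Rightarrow> real"
  assumes flat: "\<And>\<alpha> \<nu> \<mu> \<sigma>. P \<alpha> \<nu> \<mu> \<sigma> - P \<alpha> \<nu> \<sigma> \<mu> + (\<Sum>\<epsilon>\<in>UNIV. \<Gamma> \<epsilon> \<nu> \<mu> * \<Gamma> \<alpha> \<epsilon> \<sigma>)
      - (\<Sum>\<epsilon>\<in>UNIV. \<Gamma> \<epsilon> \<nu> \<sigma> * \<Gamma> \<alpha> \<epsilon> \<mu>) + Q \<alpha> \<nu> \<mu> \<sigma> = 0"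
    and sym: "\<And>\<alpha> \<mu> \<nu>. \<Gamma>' \<alpha> \<mu> \<nu> = \<Gamma>' \<alpha> \<nu> \<mu>"
    and tr: "\<And>\<mu>. (\<Sum>\<alpha>\<in>UNIV. \<Gamma>' \<alpha> \<mu> \<alpha>) = (\<Sum>\<alpha>\<in>UNIV. \<Gamma> \<alpha> \<alpha> \<mu>)"
    and trP: "(\<Sum>\<alpha>\<in>UNIV. P' \<alpha> \<mu> \<alpha> \<sigma>) = (\<Sum>\<alpha>\<in>UNIV. P \<alpha> \<alpha> \<mu> \<sigma>)"
    and \<gamma>: "\<gamma> = (\<lambda>\<alpha> \<mu> \<nu>. \<Gamma> \<alpha> \<mu> \<nu> - \<Gamma>' \<alpha> \<mu> \<nu>)"
    and \<beta>: "\<beta> = (\<lambda>\<mu>. \<Sum>\<alpha>\<in>UNIV. \<Gamma> \<alpha> \<mu> \<alpha> - \<Gamma> \<alpha> \<alpha> \<mu>)"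
  shows "(\<Sum>\<alpha>\<in>UNIV. P' \<alpha> \<mu> \<sigma> \<alpha> - P' \<alpha> \<mu> \<alpha> \<sigma> + (\<Sum>\<epsilon>\<in>UNIV. \<Gamma>' \<epsilon> \<mu> \<sigma> * \<Gamma>' \<alpha> \<epsilon> \<alpha>)
        - (\<Sum>\<epsilon>\<in>UNIV. \<Gamma>' \<epsilon> \<mu> \<alpha> * \<Gamma>' \<alpha> \<epsilon> \<sigma>) + Q' \<alpha> \<mu> \<sigma> \<alpha>)
    = ((\<Sum>\<alpha>\<in>UNIV. P \<alpha> \<mu> \<alpha> \<sigma> - P \<alpha> \<alpha> \<mu> \<sigma>) - (\<Sum>\<epsilon>\<in>UNIV. \<beta> \<epsilon> * \<Gamma> \<epsilon> \<mu> \<sigma>))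
      - (\<Sum>\<alpha>\<in>UNIV. P \<alpha> \<mu> \<sigma> \<alpha> - P' \<alpha> \<mu> \<sigma> \<alpha> + (\<Sum>\<epsilon>\<in>UNIV. \<gamma> \<epsilon> \<mu> \<sigma> * \<Gamma> \<alpha> \<epsilon> \<alpha>)
          - (\<Sum>\<epsilon>\<in>UNIV. \<gamma> \<alpha> \<epsilon> \<sigma> * \<Gamma> \<epsilon> \<mu> \<alpha>) - (\<Sum>\<epsilon>\<in>UNIV. \<gamma> \<alpha> \<mu> \<epsilon> * \<Gamma> \<epsilon> \<sigma> \<alpha>))
      + (\<Sum>\<epsilon>\<in>UNIV. \<beta> \<epsilon> * \<gamma> \<epsilon> \<mu> \<sigma>)
      - (\<Sum>\<alpha>\<in>UNIV. \<Sum>\<epsilon>\<in>UNIV. \<gamma> \<alpha> \<mu> \<epsilon> * \<gamma> \<epsilon> \<sigma> \<alpha>)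
      - (\<Sum>\<alpha>\<in>UNIV. Q \<alpha> \<mu> \<sigma> \<alpha> - Q' \<alpha> \<mu> \<sigma> \<alpha>)"
proof -
  have 1: "(\<Sum>\<alpha>\<in>UNIV. P \<alpha> \<mu> \<sigma> \<alpha> - P \<alpha> \<mu> \<alpha> \<sigma> + (\<Sum>\<epsilon>\<in>UNIV. \<Gamma> \<epsilon> \<mu> \<sigma> * \<Gamma> \<alpha> \<epsilon> \<alpha>)
      - (\<Sum>\<epsilon>\<in>UNIV. \<Gamma> \<epsilon> \<mu> \<alpha> * \<Gamma> \<alpha> \<epsilon> \<sigma>) + Q \<alpha> \<mu> \<sigma> \<alpha>) = 0"
    using flat by (intro sum.neutral) simp
  have \<beta>\<gamma>: "\<beta> \<epsilon> = (\<Sum>\<alpha>\<in>UNIV. \<gamma> \<alpha> \<epsilon> \<alpha>)" for \<epsilon>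
    using tr[of \<epsilon>] by (simp add: \<beta> \<gamma> sum_subtractf)
  have 2: "(\<Sum>\<epsilon>\<in>UNIV. \<beta> \<epsilon> * k \<epsilon>) = (\<Sum>\<alpha>\<in>UNIV. \<Sum>\<epsilon>\<in>UNIV. \<gamma> \<alpha> \<epsilon> \<alpha> * k \<epsilon>)" for k
    unfolding \<beta>\<gamma> sum_distrib_right by (rule sum.swap)
  have 3: "(\<Sum>\<epsilon>\<in>UNIV. \<Gamma>' \<epsilon> \<mu> \<sigma> * \<Gamma>' \<alpha> \<epsilon> \<alpha>) = (\<Sum>\<epsilon>\<in>UNIV. \<Gamma> \<epsilon> \<mu> \<sigma> * \<Gamma> \<alpha> \<epsilon> \<alpha>)
      - (\<Sum>\<epsilon>\<in>UNIV. \<gamma> \<alpha> \<epsilon> \<alpha> * \<Gamma> \<epsilon> \<mu> \<sigma>) - (\<Sum>\<epsilon>\<in>UNIV. \<gamma> \<epsilon> \<mu> \<sigma> * \<Gamma> \<alpha> \<epsilon> \<alpha>)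
      + (\<Sum>\<epsilon>\<in>UNIV. \<gamma> \<alpha> \<epsilon> \<alpha> * \<gamma> \<epsilon> \<mu> \<sigma>)" for \<alpha>
    unfolding sum.distrib[symmetric] sum_subtractf[symmetric] \<gamma>
    by (intro sum.cong) (auto simp: algebra_simps)
  \<comment> \<open>Symmetry of \<Gamma>' moves \<sigma> into the first lower place, so that after
    the renaming in \<open>5\<close> the last sum has the index pattern of the remaining connection
    term of \<gamma> and of the product \<gamma>\<gamma>.\<close>
  have 4: "(\<Sum>\<epsilon>\<in>UNIV. \<Gamma>' \<epsilon> \<mu> \<alpha> * \<Gamma>' \<alpha> \<epsilon> \<sigma>) = (\<Sum>\<epsilon>\<in>UNIV. \<Gamma> \<epsilon> \<mu> \<alpha> * \<Gamma> \<alpha> \<epsilon> \<sigma>)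
      - (\<Sum>\<epsilon>\<in>UNIV. \<gamma> \<alpha> \<epsilon> \<sigma> * \<Gamma> \<epsilon> \<mu> \<alpha>) - (\<Sum>\<epsilon>\<in>UNIV. \<gamma> \<epsilon> \<mu> \<alpha> * \<Gamma>' \<alpha> \<sigma> \<epsilon>)" for \<alpha>
    unfolding sum_subtractf[symmetric] \<gamma> sym[of _ \<sigma>]
    by (intro sum.cong) (auto simp: algebra_simps)
  have 5: "(\<Sum>\<alpha>\<in>UNIV. \<Sum>\<epsilon>\<in>UNIV. \<gamma> \<epsilon> \<mu> \<alpha> * \<Gamma>' \<alpha> \<sigma> \<epsilon>)
      = (\<Sum>\<alpha>\<in>UNIV. \<Sum>\<epsilon>\<in>UNIV. \<gamma> \<alpha> \<mu> \<epsilon> * \<Gamma> \<epsilon> \<sigma> \<alpha>)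
        - (\<Sum>\<alpha>\<in>UNIV. \<Sum>\<epsilon>\<in>UNIV. \<gamma> \<alpha> \<mu> \<epsilon> * \<gamma> \<epsilon> \<sigma> \<alpha>)"
    unfolding sum_subtractf[symmetric] by (subst sum.swap) (simp add: \<gamma> algebra_simps)
  show ?thesis
    using 1 trP 5 unfolding 2 3 4 by (simp add: sum.distrib sum_subtractf)
qed

section \<open>Connections determined by a frame and a derivation\<close>

text \<open>The horizontal statements are the case \<open>d = delta N\<close>, \<open>K = nl_curvature N\<close>; the vertical ones
  are the case \<open>d = dy\<close>, \<open>K = 0\<close>.\<close>

locale frame_derivation =
  fixes S :: "'n::finite point set" and lam :: "'n \<Rightarrow> 'n \<Rightarrow> 'n field"
    and d :: "'n \<Rightarrow> 'n field \<Rightarrow> 'n field" and K :: "'n \<Rightarrow> 'n \<Rightarrow> 'n \<Rightarrow> 'n field"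
  assumes open_S: "open S"
    and lam_twice: "twice_differentiable_on (lam i \<alpha>) S"
    and lam_invertible: "x \<in> S \<Longrightarrow> invertible (\<chi> j \<alpha>. lam j \<alpha> x)"
    and d_const: "x \<in> S \<Longrightarrow> d \<mu> (\<lambda>x. c) x = 0"
    and d_add: "\<lbrakk>x \<in> S; f differentiable (at x); g differentiable (at x)\<rbrakk> \<Longrightarrow>
      d \<mu> (\<lambda>x. f x + g x) x = d \<mu> f x + d \<mu> g x"
    and d_mult: "\<lbrakk>x \<in> S; f differentiable (at x); g differentiable (at x)\<rbrakk> \<Longrightarrow>
      d \<mu> (\<lambda>x. f x * g x) x = f x * d \<mu> g x + d \<mu> f x * g x"
    and d_cong: "\<lbrakk>x \<in> S; f differentiable (at x); \<And>y. y \<in> S \<Longrightarrow> f y = g y\<rbrakk> \<Longrightarrow> d \<mu> f x = d \<mu> g x"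
    and d_differentiable: "\<lbrakk>x \<in> S; twice_differentiable_on f S\<rbrakk> \<Longrightarrow> d \<mu> f differentiable (at x)"
    and d_commutator: "\<lbrakk>x \<in> S; twice_differentiable_on f S\<rbrakk> \<Longrightarrow>
      d \<sigma> (d \<mu> f) x - d \<mu> (d \<sigma> f) x = (\<Sum>\<epsilon>\<in>UNIV. K \<epsilon> \<sigma> \<mu> x * dy \<epsilon> f x)"
    and K_antisym: "x \<in> S \<Longrightarrow> K \<epsilon> \<sigma> \<mu> x = - K \<epsilon> \<mu> \<sigma> x"
begin

definition conn :: "'n \<Rightarrow> 'n \<Rightarrow> 'n \<Rightarrow> 'n field" where
  "conn \<alpha> \<mu> \<nu> x = (\<Sum>i\<in>UNIV. lam i \<alpha> x * d \<nu> (colam lam i \<mu>) x)"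

text \<open>Spelled like \<open>riemannian_h\<close> and \<open>riemannian_v\<close>, so both agree
  with it by unfolding. For \<open>delta N\<close> the directions of differentiation need not
  commute, unlike those of a coordinate frame.\<close>

definition levi_civita :: "'n \<Rightarrow> 'n \<Rightarrow> 'n \<Rightarrow> 'n field" where
  "levi_civita \<alpha> \<mu> \<nu> x =
     1/2 * (\<Sum>\<epsilon>\<in>UNIV. metric_inv lam \<alpha> \<epsilon> x *
       (d \<mu> (metric lam \<nu> \<epsilon>) x + d \<nu> (metric lam \<mu> \<epsilon>) x - d \<epsilon> (metric lam \<mu> \<nu>) x))"

section \<open>Calculus of \<open>d\<close> on the frame, and flatness of the connection of the
  frame\<close>

lemma d_sum:
  assumes "x \<in> S" "\<And>i. i \<in> I \<Longrightarrow> f i differentiable (at x)"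
  shows "d \<mu> (\<lambda>x. \<Sum>i\<in>I. f i x) x = (\<Sum>i\<in>I. d \<mu> (f i) x)"
  using assms(2) by (induction I rule: infinite_finite_induct)
    (auto simp: d_const assms(1) d_add)

lemma d_cmult:
  assumes "x \<in> S" "f differentiable (at x)"
  shows "d \<mu> (\<lambda>x. c * f x) x = c * d \<mu> f x"
  using d_mult[of x "\<lambda>_. c" f] assms by (simp add: d_const)

lemma d_diff:
  assumes "x \<in> S" "f differentiable (at x)" "g differentiable (at x)"
  shows "d \<mu> (\<lambda>x. f x - g x) x = d \<mu> f x - d \<mu> g x"
  using d_add[of x f "\<lambda>x. (-1) * g x"] d_cmult[of x g \<mu> "-1"] assms by simp

lemma colam_inverse:
  assumes "x \<in> S"
  shows lam_colam: "(\<Sum>\<alpha>\<in>UNIV. lam i \<alpha> x * colam lam j \<alpha> x) = (if i = j then 1 else 0)"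
    and colam_lam: "(\<Sum>i\<in>UNIV. colam lam i \<mu> x * lam i \<alpha> x) = (if \<mu> = \<alpha> then 1 else 0)"
proof -
  define M where "M = (\<chi> j \<alpha>. lam j \<alpha> x)"
  have M: "M ** matrix_inv M = mat 1" "matrix_inv M ** M = mat 1"
    using someI_ex[OF lam_invertible[OF assms, unfolded invertible_def]]
    by (auto simp: matrix_inv_def M_def)
  show "(\<Sum>\<alpha>\<in>UNIV. lam i \<alpha> x * colam lam j \<alpha> x) = (if i = j then 1 else 0)"
    using M(1)[THEN arg_cong, of "\<lambda>A. A $ i $ j"]
    by (simp add: matrix_matrix_mult_def mat_def colam_def M_def)
  show "(\<Sum>i\<in>UNIV. colam lam i \<mu> x * lam i \<alpha> x) = (if \<mu> = \<alpha> then 1 else 0)"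
    using M(2)[THEN arg_cong, of "\<lambda>A. A $ \<mu> $ \<alpha>"]
    by (simp add: matrix_matrix_mult_def mat_def colam_def M_def)
qed

lemma colam_twice: "twice_differentiable_on (colam lam i \<mu>) S"
  unfolding colam_def
  by (rule twice_differentiable_on_matrix_inv[OF open_S]) (simp_all add: lam_twice lam_invertible)

lemma metric_twice: "twice_differentiable_on (metric lam \<mu> \<nu>) S"
  unfolding metric_def
  by (intro twice_differentiable_on_sum[OF open_S] twice_differentiable_on_mult[OF open_S] colam_twice)

lemma colam_differentiable: "x \<in> S \<Longrightarrow> colam lam i \<mu> differentiable (at x)"
  and lam_differentiable: "x \<in> S \<Longrightarrow> lam i \<alpha> differentiable (at x)"
  using colam_twice lam_twice by (simp_all add: twice_differentiable_on_def)

lemma conn_differentiable: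
  assumes "x \<in> S"
  shows "conn \<alpha> \<mu> \<nu> differentiable (at x)"
  unfolding conn_def
  by (simp add: lam_differentiable assms d_differentiable colam_twice)

text \<open>The pairing of frame and inverse frame is constant, so the Leibniz rule moves
  \<open>d\<close> from one to the other; contraction with the frame then isolates its derivative.
  This is the parallelism of the frame.\<close>

lemma d_lam:
  assumes x: "x \<in> S"
  shows "d \<sigma> (lam i \<alpha>) x = - (\<Sum>\<beta>\<in>UNIV. lam i \<beta> x * conn \<alpha> \<beta> \<sigma> x)"
proof -
  note diff = lam_differentiable[OF x] colam_differentiable[OF x]
  have *: "(\<Sum>j\<in>UNIV. d \<sigma> (lam j \<alpha>) x * colam lam j \<beta> x) = - conn \<alpha> \<beta> \<sigma> x" for \<beta>
  proof -
    have "d \<sigma> (\<lambda>x. \<Sum>j\<in>UNIV. lam j \<alpha> x * colam lam j \<beta> x) x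
        = d \<sigma> (\<lambda>x. if \<beta> = \<alpha> then 1 else 0) x"
      by (intro d_cong x) (simp_all add: diff colam_lam mult.commute[of "lam _ _ _"])
    also have "\<dots> = 0" by (rule d_const[OF x])
    finally show ?thesis
      by (simp add: d_sum[OF x] d_mult[OF x] diff sum.distrib conn_def)
  qed
  have "- (\<Sum>\<beta>\<in>UNIV. lam i \<beta> x * conn \<alpha> \<beta> \<sigma> x)
      = (\<Sum>\<beta>\<in>UNIV. \<Sum>j\<in>UNIV. d \<sigma> (lam j \<alpha>) x * (lam i \<beta> x * colam lam j \<beta> x))"
  proof -
    have "- (\<Sum>\<beta>\<in>UNIV. lam i \<beta> x * conn \<alpha> \<beta> \<sigma> x)
        = (\<Sum>\<beta>\<in>UNIV. lam i \<beta> x * (\<Sum>j\<in>UNIV. d \<sigma> (lam j \<alpha>) x * colam lam j \<beta> x))"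
      unfolding * by (simp add: sum_negf)
    then show ?thesis by (simp add: sum_distrib_left mult.left_commute)
  qed
  also have "\<dots> = (\<Sum>j\<in>UNIV. d \<sigma> (lam j \<alpha>) x * (if i = j then 1 else 0))"
    by (subst sum.swap) (simp add: lam_colam[OF x] flip: sum_distrib_left)
  also have "\<dots> = d \<sigma> (lam i \<alpha>) x" by (simp add: if_distrib cong: if_cong)
  finally show ?thesis by simp
qed

lemma d_conn:
  assumes x: "x \<in> S"
  shows "d \<sigma> (conn \<alpha> \<nu> \<mu>) x = (\<Sum>i\<in>UNIV. lam i \<alpha> x * d \<sigma> (d \<mu> (colam lam i \<nu>)) x)
    - (\<Sum>\<epsilon>\<in>UNIV. conn \<epsilon> \<nu> \<mu> x * conn \<alpha> \<epsilon> \<sigma> x)"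
proof -
  note diff = lam_differentiable[OF x] d_differentiable[OF x colam_twice]
  have "d \<sigma> (conn \<alpha> \<nu> \<mu>) x = (\<Sum>i\<in>UNIV. lam i \<alpha> x * d \<sigma> (d \<mu> (colam lam i \<nu>)) x)
      + (\<Sum>i\<in>UNIV. d \<sigma> (lam i \<alpha>) x * d \<mu> (colam lam i \<nu>) x)"
    unfolding conn_def[abs_def] by (simp add: d_sum[OF x] d_mult[OF x] diff sum.distrib)
  also have "(\<Sum>i\<in>UNIV. d \<sigma> (lam i \<alpha>) x * d \<mu> (colam lam i \<nu>) x)
      = - (\<Sum>i\<in>UNIV. \<Sum>\<epsilon>\<in>UNIV. lam i \<epsilon> x * d \<mu> (colam lam i \<nu>) x * conn \<alpha> \<epsilon> \<sigma> x)"
    unfolding d_lam[OF x] mult_minus_left sum_negf sum_distrib_right by (simp add: mult_ac)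
  also have "\<dots> = - (\<Sum>\<epsilon>\<in>UNIV. conn \<epsilon> \<nu> \<mu> x * conn \<alpha> \<epsilon> \<sigma> x)"
    by (subst sum.swap) (simp add: conn_def[of _ \<nu> \<mu>] sum_distrib_right)
  finally show ?thesis by simp
qed

text \<open>By \<open>d_conn\<close> the quadratic terms cancel, leaving the commutator of
  \<open>d\<close> on the inverse frame, which is \<open>K\<close> times its \<open>dy\<close>
  derivatives. Contraction with the frame turns these into \<open>canonical_v\<close>, whatever
  \<open>d\<close> is, and the result is opposite to the last sum.\<close>

lemma conn_flat:
  assumes x: "x \<in> S"
  shows "d \<sigma> (conn \<alpha> \<nu> \<mu>) x - d \<mu> (conn \<alpha> \<nu> \<sigma>) x
    + (\<Sum>\<epsilon>\<in>UNIV. conn \<epsilon> \<nu> \<mu> x * conn \<alpha> \<epsilon> \<sigma> x)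
    - (\<Sum>\<epsilon>\<in>UNIV. conn \<epsilon> \<nu> \<sigma> x * conn \<alpha> \<epsilon> \<mu> x)
    + (\<Sum>\<epsilon>\<in>UNIV. canonical_v lam \<alpha> \<nu> \<epsilon> x * K \<epsilon> \<mu> \<sigma> x) = 0"
proof -
  have "(\<Sum>\<epsilon>\<in>UNIV. canonical_v lam \<alpha> \<nu> \<epsilon> x * K \<epsilon> \<mu> \<sigma> x)
      = (\<Sum>\<epsilon>\<in>UNIV. \<Sum>i\<in>UNIV. lam i \<alpha> x * (K \<epsilon> \<mu> \<sigma> x * dy \<epsilon> (colam lam i \<nu>) x))"
    unfolding canonical_v_def sum_distrib_right by (simp add: mult_ac)
  also have "\<dots> = (\<Sum>i\<in>UNIV. lam i \<alpha> x * (\<Sum>\<epsilon>\<in>UNIV. K \<epsilon> \<mu> \<sigma> x * dy \<epsilon> (colam lam i \<nu>) x))"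
    by (subst sum.swap) (simp add: sum_distrib_left)
  also have "\<dots> = (\<Sum>i\<in>UNIV. lam i \<alpha> x * d \<mu> (d \<sigma> (colam lam i \<nu>)) x)
      - (\<Sum>i\<in>UNIV. lam i \<alpha> x * d \<sigma> (d \<mu> (colam lam i \<nu>)) x)"
    by (simp add: d_commutator[OF x colam_twice, symmetric] right_diff_distrib sum_subtractf)
  finally show ?thesis by (simp add: d_conn[OF x])
qed

text \<open>For the frame matrix M with inverse W the metric is W times its transpose, so the
  transpose of M times M inverts it; inverses are unique.\<close>

lemma metric_inv_eq:
  assumes x: "x \<in> S"
  shows "metric_inv lam \<mu> \<nu> x = (\<Sum>i\<in>UNIV. lam i \<mu> x * lam i \<nu> x)"
proof -
  define g h :: "real^'n^'n" where "g = (\<chi> \<alpha> \<beta>. metric lam \<alpha> \<beta> x)"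
    and "h = (\<chi> \<alpha> \<beta>. \<Sum>i\<in>UNIV. lam i \<alpha> x * lam i \<beta> x)"
  define M where "M = (\<chi> j \<alpha>. lam j \<alpha> x)"
  define W where "W = matrix_inv M"
  have M: "M ** W = mat 1" "W ** M = mat 1"
    using someI_ex[OF lam_invertible[OF x, unfolded invertible_def]]
    by (auto simp: matrix_inv_def M_def W_def)
  have g: "g = W ** transpose W"
    by (simp add: g_def W_def M_def metric_def colam_def transpose_def matrix_matrix_mult_def)
  have h: "h = transpose M ** M"
    by (simp add: h_def M_def transpose_def matrix_matrix_mult_def)
  have gh: "g ** h = mat 1"
    unfolding g h
    by (metis M matrix_mul_assoc matrix_mul_rid matrix_transpose_mul transpose_mat)
  then have hg: "h ** g = mat 1" using matrix_left_right_inverse by blast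
  have "g ** matrix_inv g = mat 1"
    using someI_ex[of "\<lambda>A'. g ** A' = mat 1 \<and> A' ** g = mat 1"] gh hg
    unfolding matrix_inv_def by blast
  then have "matrix_inv g = h"
    by (metis hg matrix_mul_assoc matrix_mul_lid matrix_mul_rid)
  then show ?thesis by (simp add: metric_inv_def g_def h_def)
qed

section \<open>Symmetry, regularity and trace of the Riemannian coefficients\<close>

lemma levi_civita_sym: "levi_civita \<alpha> \<mu> \<nu> = levi_civita \<alpha> \<nu> \<mu>"
proof -
  have "metric lam \<mu> \<nu> = metric lam \<nu> \<mu>"
    by (simp add: fun_eq_iff metric_def mult.commute)
  then show ?thesis unfolding levi_civita_def[abs_def] by (simp add: add.commute)
qed

text \<open>On \<open>S\<close> the inverse metric is a polynomial in the frame by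
  \<open>metric_inv_eq\<close>, so only the first derivatives of the metric need attention, and
  those are differentiable.\<close>

lemma levi_civita_differentiable:
  assumes x: "x \<in> S"
  shows "levi_civita \<alpha> \<mu> \<nu> differentiable (at x)"
proof (rule differentiable_at_cong_open[OF open_S x])
  show "(1/2) * (\<Sum>\<epsilon>\<in>UNIV. (\<Sum>i\<in>UNIV. lam i \<alpha> y * lam i \<epsilon> y) *
       (d \<mu> (metric lam \<nu> \<epsilon>) y + d \<nu> (metric lam \<mu> \<epsilon>) y - d \<epsilon> (metric lam \<mu> \<nu>) y))
      = levi_civita \<alpha> \<mu> \<nu> y" if "y \<in> S" for y
    by (simp add: levi_civita_def metric_inv_eq[OF that])
  show "(\<lambda>y. (1/2) * (\<Sum>\<epsilon>\<in>UNIV. (\<Sum>i\<in>UNIV. lam i \<alpha> y * lam i \<epsilon> y) *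
       (d \<mu> (metric lam \<nu> \<epsilon>) y + d \<nu> (metric lam \<mu> \<epsilon>) y - d \<epsilon> (metric lam \<mu> \<nu>) y)))
      differentiable (at x)"
    by (intro differentiable_mult differentiable_const)
      (simp add: lam_differentiable x d_differentiable metric_twice)
qed

text \<open>In the trace, the two derivatives of the metric not taken along \<mu> cancel, since the
  inverse metric is symmetric. The rest, half of g^{\<epsilon>\<alpha>} d_\<mu>
  g_{\<epsilon>\<alpha>}, splits by the Leibniz rule into two equal parts. Both sides are the
  logarithmic derivative of the volume density.\<close>

lemma levi_civita_trace:
  assumes x: "x \<in> S"
  shows "(\<Sum>\<epsilon>\<in>UNIV. levi_civita \<epsilon> \<mu> \<epsilon> x) = (\<Sum>\<epsilon>\<in>UNIV. conn \<epsilon> \<epsilon> \<mu> x)"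
proof -
  note diff = colam_differentiable[OF x]
  have inv_sym: "metric_inv lam \<epsilon> \<alpha> x = metric_inv lam \<alpha> \<epsilon> x" for \<epsilon> \<alpha>
    by (simp add: metric_inv_eq[OF x] mult.commute)
  have raise: "(\<Sum>\<alpha>\<in>UNIV. metric_inv lam \<epsilon> \<alpha> x * colam lam i \<alpha> x) = lam i \<epsilon> x" for \<epsilon> i
  proof -
    have "(\<Sum>\<alpha>\<in>UNIV. metric_inv lam \<epsilon> \<alpha> x * colam lam i \<alpha> x)
        = (\<Sum>\<alpha>\<in>UNIV. \<Sum>j\<in>UNIV. lam j \<epsilon> x * (lam j \<alpha> x * colam lam i \<alpha> x))"
      by (simp add: metric_inv_eq[OF x] sum_distrib_right mult.assoc)
    also have "\<dots> = (\<Sum>j\<in>UNIV. lam j \<epsilon> x * (if j = i then 1 else 0))"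
      by (subst sum.swap) (simp add: lam_colam[OF x] flip: sum_distrib_left)
    finally show ?thesis by (simp add: if_distrib cong: if_cong)
  qed
  have half: "(\<Sum>\<epsilon>\<in>UNIV. \<Sum>\<alpha>\<in>UNIV. metric_inv lam \<epsilon> \<alpha> x *
      (\<Sum>i\<in>UNIV. colam lam i \<alpha> x * d \<mu> (colam lam i \<epsilon>) x)) = (\<Sum>\<epsilon>\<in>UNIV. conn \<epsilon> \<epsilon> \<mu> x)"
  proof (rule sum.cong)
    fix \<epsilon>
    have "(\<Sum>\<alpha>\<in>UNIV. metric_inv lam \<epsilon> \<alpha> x * (\<Sum>i\<in>UNIV. colam lam i \<alpha> x * d \<mu> (colam lam i \<epsilon>) x))
        = (\<Sum>i\<in>UNIV. (\<Sum>\<alpha>\<in>UNIV. metric_inv lam \<epsilon> \<alpha> x * colam lam i \<alpha> x) * d \<mu> (colam lam i \<epsilon>) x)"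
      unfolding sum_distrib_left sum_distrib_right by (subst sum.swap) (simp add: mult_ac)
    then show "(\<Sum>\<alpha>\<in>UNIV. metric_inv lam \<epsilon> \<alpha> x *
        (\<Sum>i\<in>UNIV. colam lam i \<alpha> x * d \<mu> (colam lam i \<epsilon>) x)) = conn \<epsilon> \<epsilon> \<mu> x"
      by (simp add: raise conn_def)
  qed simp
  have half': "(\<Sum>\<epsilon>\<in>UNIV. \<Sum>\<alpha>\<in>UNIV. metric_inv lam \<epsilon> \<alpha> x *
      (\<Sum>i\<in>UNIV. colam lam i \<epsilon> x * d \<mu> (colam lam i \<alpha>) x)) = (\<Sum>\<epsilon>\<in>UNIV. conn \<epsilon> \<epsilon> \<mu> x)"
    unfolding half[symmetric] by (subst sum.swap) (simp add: inv_sym)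
  have dg: "d \<mu> (metric lam \<epsilon> \<alpha>) x = (\<Sum>i\<in>UNIV. colam lam i \<epsilon> x * d \<mu> (colam lam i \<alpha>) x)
      + (\<Sum>i\<in>UNIV. colam lam i \<alpha> x * d \<mu> (colam lam i \<epsilon>) x)" for \<epsilon> \<alpha>
    unfolding metric_def[abs_def]
    by (simp add: d_sum[OF x] d_mult[OF x] diff sum.distrib mult.commute)
  have "metric lam \<mu> \<epsilon> = metric lam \<epsilon> \<mu>" for \<epsilon>
    by (simp add: fun_eq_iff metric_def mult.commute)
  then have "(\<Sum>\<epsilon>\<in>UNIV. \<Sum>\<alpha>\<in>UNIV. metric_inv lam \<epsilon> \<alpha> x * d \<epsilon> (metric lam \<mu> \<alpha>) x)
      = (\<Sum>\<epsilon>\<in>UNIV. \<Sum>\<alpha>\<in>UNIV. metric_inv lam \<epsilon> \<alpha> x * d \<alpha> (metric lam \<mu> \<epsilon>) x)"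
    by (subst sum.swap) (simp add: inv_sym)
  then have "2 * (\<Sum>\<epsilon>\<in>UNIV. levi_civita \<epsilon> \<mu> \<epsilon> x)
      = (\<Sum>\<epsilon>\<in>UNIV. \<Sum>\<alpha>\<in>UNIV. metric_inv lam \<epsilon> \<alpha> x * d \<mu> (metric lam \<epsilon> \<alpha>) x)"
    by (simp add: levi_civita_def sum_distrib_left[symmetric] sum_divide_distrib[symmetric]
        ring_distribs sum.distrib sum_subtractf)
  also have "\<dots> = 2 * (\<Sum>\<epsilon>\<in>UNIV. conn \<epsilon> \<epsilon> \<mu> x)"
    by (simp add: dg distrib_left sum.distrib half half')
  finally show ?thesis by simp
qed

text \<open>The trace relation holds on the whole open set and not only at \<open>x\<close>, so
  \<open>d_cong\<close> permits differentiating it.\<close>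

lemma d_levi_civita_trace:
  assumes x: "x \<in> S"
  shows "(\<Sum>\<epsilon>\<in>UNIV. d \<sigma> (levi_civita \<epsilon> \<mu> \<epsilon>) x) = (\<Sum>\<epsilon>\<in>UNIV. d \<sigma> (conn \<epsilon> \<epsilon> \<mu>) x)"
proof -
  have "d \<sigma> (\<lambda>x. \<Sum>\<epsilon>\<in>UNIV. levi_civita \<epsilon> \<mu> \<epsilon> x) x = d \<sigma> (\<lambda>x. \<Sum>\<epsilon>\<in>UNIV. conn \<epsilon> \<epsilon> \<mu> x) x"
    using levi_civita_differentiable[OF x] levi_civita_trace
    by (intro d_cong x differentiable_sum) auto
  then show ?thesis
    by (simp add: d_sum[OF x] levi_civita_differentiable[OF x] conn_differentiable[OF x])
qed

section \<open>Contracted curvatures of the dual, symmetric and Riemannian coefficients\<close>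

lemma d_contracted_torsion:
  assumes x: "x \<in> S"
  shows "d \<sigma> (contracted_torsion (torsion conn) \<mu>) x
    = (\<Sum>\<alpha>\<in>UNIV. d \<sigma> (conn \<alpha> \<mu> \<alpha>) x - d \<sigma> (conn \<alpha> \<alpha> \<mu>) x)"
  unfolding contracted_torsion_def[abs_def] torsion_def
  by (simp add: d_sum[OF x] d_diff[OF x] conn_differentiable[OF x])

text \<open>The left side is the contracted curvature of the dual connection without its own C R
  term, which depends on the dual vertical coefficients and is added later; the sums with
  \<open>K\<close> come from flatness of the canonical connection.\<close>

theorem ricci_dual:
  assumes x: "x \<in> S"
  shows "(\<Sum>\<alpha>\<in>UNIV. d \<alpha> (dual_coeff conn \<alpha> \<mu> \<sigma>) x - d \<sigma> (dual_coeff conn \<alpha> \<mu> \<alpha>) x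
      + (\<Sum>\<epsilon>\<in>UNIV. dual_coeff conn \<epsilon> \<mu> \<sigma> x * dual_coeff conn \<alpha> \<epsilon> \<alpha> x)
      - (\<Sum>\<epsilon>\<in>UNIV. dual_coeff conn \<epsilon> \<mu> \<alpha> x * dual_coeff conn \<alpha> \<epsilon> \<sigma> x))
    = cov_01 d conn (contracted_torsion (torsion conn)) \<sigma> \<mu> x
      + (\<Sum>\<alpha>\<in>UNIV. \<Sum>\<epsilon>\<in>UNIV. canonical_v lam \<alpha> \<sigma> \<epsilon> x * K \<epsilon> \<alpha> \<mu> x)
      + (\<Sum>\<alpha>\<in>UNIV. \<Sum>\<epsilon>\<in>UNIV. canonical_v lam \<alpha> \<alpha> \<epsilon> x * K \<epsilon> \<mu> \<sigma> x)"
proof -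
  have dual: "dual_coeff conn \<alpha> \<mu> \<nu> = conn \<alpha> \<nu> \<mu>" for \<alpha> \<mu> \<nu>
    by (simp add: fun_eq_iff dual_coeff_def)
  have antisym: "(\<Sum>\<epsilon>\<in>UNIV. canonical_v lam \<alpha> \<nu> \<epsilon> x * K \<epsilon> \<mu> \<sigma> x)
      = - (\<Sum>\<epsilon>\<in>UNIV. canonical_v lam \<alpha> \<nu> \<epsilon> x * K \<epsilon> \<sigma> \<mu> x)" for \<alpha> \<nu> \<mu> \<sigma>
    by (simp add: K_antisym[OF x, of _ \<mu> \<sigma>] sum_negf)
  show ?thesis
    unfolding dual cov_01_def d_contracted_torsion[OF x] contracted_torsion_def torsion_def
    by (rule ricci_dual_identity[where \<Gamma> = "\<lambda>\<alpha> \<mu> \<nu>. conn \<alpha> \<mu> \<nu> x"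
          and P = "\<lambda>\<alpha> \<mu> \<nu> \<sigma>. d \<sigma> (conn \<alpha> \<mu> \<nu>) x"
          and Q = "\<lambda>\<alpha> \<nu> \<mu> \<sigma>. \<Sum>\<epsilon>\<in>UNIV. canonical_v lam \<alpha> \<nu> \<epsilon> x * K \<epsilon> \<mu> \<sigma> x"])
      (fact conn_flat[OF x] antisym)+
qed

text \<open>\<open>Q'\<close> is the slot for the C R term of the dual connection. The symmetric
  vertical coefficients are a mean, so their C R term is the mean of the canonical one and
  \<open>Q'\<close>.\<close>

theorem ricci_sym:
  fixes Q' :: "'n \<Rightarrow> 'n \<Rightarrow> 'n \<Rightarrow> 'n \<Rightarrow> real"
  assumes x: "x \<in> S"
  shows "(\<Sum>\<alpha>\<in>UNIV. d \<alpha> (sym_coeff conn \<alpha> \<mu> \<sigma>) x - d \<sigma> (sym_coeff conn \<alpha> \<mu> \<alpha>) x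
      + (\<Sum>\<epsilon>\<in>UNIV. sym_coeff conn \<epsilon> \<mu> \<sigma> x * sym_coeff conn \<alpha> \<epsilon> \<alpha> x)
      - (\<Sum>\<epsilon>\<in>UNIV. sym_coeff conn \<epsilon> \<mu> \<alpha> x * sym_coeff conn \<alpha> \<epsilon> \<sigma> x)
      + 1/2 * ((\<Sum>\<epsilon>\<in>UNIV. canonical_v lam \<alpha> \<mu> \<epsilon> x * K \<epsilon> \<sigma> \<alpha> x) + Q' \<alpha> \<mu> \<sigma> \<alpha>))
    = 1/2 * (\<Sum>\<alpha>\<in>UNIV. d \<alpha> (dual_coeff conn \<alpha> \<mu> \<sigma>) x - d \<sigma> (dual_coeff conn \<alpha> \<mu> \<alpha>) x
      + (\<Sum>\<epsilon>\<in>UNIV. dual_coeff conn \<epsilon> \<mu> \<sigma> x * dual_coeff conn \<alpha> \<epsilon> \<alpha> x)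
      - (\<Sum>\<epsilon>\<in>UNIV. dual_coeff conn \<epsilon> \<mu> \<alpha> x * dual_coeff conn \<alpha> \<epsilon> \<sigma> x) + Q' \<alpha> \<mu> \<sigma> \<alpha>)
    + 1/4 * ((\<Sum>\<epsilon>\<in>UNIV. contracted_torsion (torsion conn) \<epsilon> x * torsion conn \<epsilon> \<sigma> \<mu> x)
           + (\<Sum>\<epsilon>\<in>UNIV. \<Sum>\<alpha>\<in>UNIV. torsion conn \<epsilon> \<alpha> \<sigma> x * torsion conn \<alpha> \<mu> \<epsilon> x))"
proof -
  have dual: "dual_coeff conn \<alpha> \<mu> \<nu> = conn \<alpha> \<nu> \<mu>" for \<alpha> \<mu> \<nu>
    by (simp add: fun_eq_iff dual_coeff_def)
  have d_sym: "d \<sigma> (sym_coeff conn \<alpha> \<mu> \<nu>) x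
      = 1/2 * (d \<sigma> (conn \<alpha> \<mu> \<nu>) x + d \<sigma> (conn \<alpha> \<nu> \<mu>) x)" for \<sigma> \<alpha> \<mu> \<nu>
    unfolding sym_coeff_def[abs_def]
    by (subst d_cmult[OF x]) (simp_all add: d_add[OF x] conn_differentiable[OF x])
  show ?thesis
    unfolding dual d_sym contracted_torsion_def
    by (rule ricci_sym_identity[where \<Gamma> = "\<lambda>\<alpha> \<mu> \<nu>. conn \<alpha> \<mu> \<nu> x"
          and P = "\<lambda>\<alpha> \<mu> \<nu> \<sigma>. d \<sigma> (conn \<alpha> \<mu> \<nu>) x"
          and Q = "\<lambda>\<alpha> \<nu> \<mu> \<sigma>. \<Sum>\<epsilon>\<in>UNIV. canonical_v lam \<alpha> \<nu> \<epsilon> x * K \<epsilon> \<mu> \<sigma> x"])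
      (use conn_flat[OF x] in \<open>auto simp: fun_eq_iff sym_coeff_def torsion_def\<close>)
qed

text \<open>\<open>Q'\<close> is the slot for the C R term of the Riemannian connection; on the
  right it meets the canonical one, and their difference becomes the G R term.\<close>

theorem ricci_levi_civita:
  fixes Q' :: "'n \<Rightarrow> 'n \<Rightarrow> 'n \<Rightarrow> 'n \<Rightarrow> real"
  assumes x: "x \<in> S"
  shows "(\<Sum>\<alpha>\<in>UNIV. d \<alpha> (levi_civita \<alpha> \<mu> \<sigma>) x - d \<sigma> (levi_civita \<alpha> \<mu> \<alpha>) x
      + (\<Sum>\<epsilon>\<in>UNIV. levi_civita \<epsilon> \<mu> \<sigma> x * levi_civita \<alpha> \<epsilon> \<alpha> x)
      - (\<Sum>\<epsilon>\<in>UNIV. levi_civita \<epsilon> \<mu> \<alpha> x * levi_civita \<alpha> \<epsilon> \<sigma> x) + Q' \<alpha> \<mu> \<sigma> \<alpha>)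
    = cov_01 d conn (contracted_torsion (torsion conn)) \<mu> \<sigma> x
      - (\<Sum>\<alpha>\<in>UNIV. cov_12 d conn (contortion conn levi_civita) \<alpha> \<mu> \<sigma> \<alpha> x)
      + (\<Sum>\<epsilon>\<in>UNIV. contracted_torsion (torsion conn) \<epsilon> x * contortion conn levi_civita \<epsilon> \<mu> \<sigma> x)
      - (\<Sum>\<alpha>\<in>UNIV. \<Sum>\<epsilon>\<in>UNIV.
          contortion conn levi_civita \<alpha> \<mu> \<epsilon> x * contortion conn levi_civita \<epsilon> \<sigma> \<alpha> x)
      - (\<Sum>\<alpha>\<in>UNIV. (\<Sum>\<epsilon>\<in>UNIV. canonical_v lam \<alpha> \<mu> \<epsilon> x * K \<epsilon> \<sigma> \<alpha> x) - Q' \<alpha> \<mu> \<sigma> \<alpha>)"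
proof -
  have d_contortion: "d \<sigma> (contortion conn levi_civita \<alpha> \<mu> \<nu>) x
      = d \<sigma> (conn \<alpha> \<mu> \<nu>) x - d \<sigma> (levi_civita \<alpha> \<mu> \<nu>) x" for \<sigma> \<alpha> \<mu> \<nu>
    unfolding contortion_def[abs_def]
    by (simp add: d_diff[OF x] conn_differentiable[OF x] levi_civita_differentiable[OF x])
  show ?thesis
    unfolding cov_01_def cov_12_def d_contracted_torsion[OF x] d_contortion
    by (rule ricci_symmetric_connection_identity[where \<Gamma> = "\<lambda>\<alpha> \<mu> \<nu>. conn \<alpha> \<mu> \<nu> x"
          and P = "\<lambda>\<alpha> \<mu> \<nu> \<sigma>. d \<sigma> (conn \<alpha> \<mu> \<nu>) x"
          and \<Gamma>' = "\<lambda>\<alpha> \<mu> \<nu>. levi_civita \<alpha> \<mu> \<nu> x"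
          and P' = "\<lambda>\<alpha> \<mu> \<nu> \<sigma>. d \<sigma> (levi_civita \<alpha> \<mu> \<nu>) x"
          and Q = "\<lambda>\<alpha> \<nu> \<mu> \<sigma>. \<Sum>\<epsilon>\<in>UNIV. canonical_v lam \<alpha> \<nu> \<epsilon> x * K \<epsilon> \<mu> \<sigma> x"
          and \<gamma> = "\<lambda>\<alpha> \<mu> \<nu>. contortion conn levi_civita \<alpha> \<mu> \<nu> x"
          and \<beta> = "\<lambda>\<mu>. contracted_torsion (torsion conn) \<mu> x"])
      (fact conn_flat[OF x] levi_civita_sym[THEN fun_cong] levi_civita_trace[OF x]
        d_levi_civita_trace[OF x]
       | simp add: contortion_def contracted_torsion_def torsion_def)+
qed

end

section \<open>Horizontal and vertical derivations\<close>

lemma dx_frechet: "dx \<mu> f = (\<lambda>x. frechet_derivative f (at x) (axis \<mu> 1, 0))"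
  by (simp only: fun_eq_iff dx_def simp_thms)

lemma dy_frechet: "dy \<mu> f = (\<lambda>x. frechet_derivative f (at x) (0, axis \<mu> 1))"
  by (simp only: fun_eq_iff dy_def simp_thms)

lemma point_axes_in_Basis [simp]:
  "(axis \<mu> 1, 0) \<in> (Basis :: 'n::finite point set)" "(0, axis \<mu> 1) \<in> (Basis :: 'n point set)"
  by (auto simp: Basis_prod_def axis_in_Basis_iff)

lemma partials_commute:
  assumes S: "open S" "x \<in> S" and f: "twice_differentiable_on f S"
  shows "dx \<sigma> (dx \<mu> f) x = dx \<mu> (dx \<sigma> f) x" "dx \<sigma> (dy \<mu> f) x = dy \<mu> (dx \<sigma> f) x"
    "dy \<sigma> (dy \<mu> f) x = dy \<mu> (dy \<sigma> f) x"
  unfolding dx_frechet dy_frechet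
  by (rule frechet_derivative_commute[OF S]; use S f in \<open>simp add: twice_differentiable_on_def\<close>)+

lemma partials_differentiable:
  assumes "x \<in> S" "twice_differentiable_on f S"
  shows "dx \<mu> f differentiable (at x)" "dy \<mu> f differentiable (at x)"
  using assms unfolding dx_frechet dy_frechet by (simp_all add: twice_differentiable_on_def)

lemma partials_cong:
  assumes "open S" "x \<in> S" "f differentiable (at x)" "\<And>y. y \<in> S \<Longrightarrow> f y = g y"
  shows "dx \<mu> f x = dx \<mu> g x" "dy \<mu> f x = dy \<mu> g x"
  unfolding dx_def dy_def using frechet_derivative_transform_within_open[OF assms(3,1,2,4)] by simp_all

lemma partials_const: "dx \<mu> (\<lambda>x. c) x = 0" "dy \<mu> (\<lambda>x. c) x = 0"
  by (simp_all add: dx_def dy_def)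

lemma partials_add:
  assumes "f differentiable (at x)" "g differentiable (at x)"
  shows "dx \<mu> (\<lambda>x. f x + g x) x = dx \<mu> f x + dx \<mu> g x"
    "dy \<mu> (\<lambda>x. f x + g x) x = dy \<mu> f x + dy \<mu> g x"
  using assms by (simp_all add: dx_def dy_def frechet_derivative_add_at)

lemma partials_mult:
  assumes "f differentiable (at x)" "g differentiable (at x)"
  shows "dx \<mu> (\<lambda>x. f x * g x) x = f x * dx \<mu> g x + dx \<mu> f x * g x"
    "dy \<mu> (\<lambda>x. f x * g x) x = f x * dy \<mu> g x + dy \<mu> f x * g x"
  using assms by (simp_all add: dx_def dy_def frechet_derivative_mult_at)

lemma delta_add:
  assumes "f differentiable (at x)" "g differentiable (at x)"
  shows "delta N \<mu> (\<lambda>x. f x + g x) x = delta N \<mu> f x + delta N \<mu> g x"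
  using assms by (simp add: delta_def partials_add distrib_left sum.distrib)

lemma delta_mult:
  assumes "f differentiable (at x)" "g differentiable (at x)"
  shows "delta N \<mu> (\<lambda>x. f x * g x) x = f x * delta N \<mu> g x + delta N \<mu> f x * g x"
proof -
  have "(\<Sum>\<alpha>\<in>UNIV. N \<alpha> \<mu> x * (f x * dy \<alpha> g x + dy \<alpha> f x * g x))
      = f x * (\<Sum>\<alpha>\<in>UNIV. N \<alpha> \<mu> x * dy \<alpha> g x) + (\<Sum>\<alpha>\<in>UNIV. N \<alpha> \<mu> x * dy \<alpha> f x) * g x"
    unfolding sum_distrib_left sum_distrib_right sum.distrib[symmetric]
    by (simp add: algebra_simps)
  then show ?thesis using assms by (simp add: delta_def partials_mult algebra_simps)
qed

lemma partials_delta: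
  assumes x: "x \<in> S" and f: "twice_differentiable_on f S"
    and N: "\<And>\<alpha> \<mu>. N \<alpha> \<mu> differentiable (at x)"
  shows "delta N \<mu> f differentiable (at x)"
    and "dx \<sigma> (delta N \<mu> f) x = dx \<sigma> (dx \<mu> f) x
      - (\<Sum>\<alpha>\<in>UNIV. N \<alpha> \<mu> x * dx \<sigma> (dy \<alpha> f) x + dx \<sigma> (N \<alpha> \<mu>) x * dy \<alpha> f x)"
    and "dy \<sigma> (delta N \<mu> f) x = dy \<sigma> (dx \<mu> f) x
      - (\<Sum>\<alpha>\<in>UNIV. N \<alpha> \<mu> x * dy \<sigma> (dy \<alpha> f) x + dy \<sigma> (N \<alpha> \<mu>) x * dy \<alpha> f x)"
proof -
  note diff = partials_differentiable[OF x f] N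
  show "delta N \<mu> f differentiable (at x)"
    unfolding delta_def[abs_def] by (simp add: diff)
  note works = diff[unfolded frechet_derivative_works]
  \<comment> \<open>The derivative is found once as a linear map and then evaluated along the x- and
    the y-axes.\<close>
  have "frechet_derivative (delta N \<mu> f) (at x) = (\<lambda>v. frechet_derivative (dx \<mu> f) (at x) v
      - (\<Sum>\<alpha>\<in>UNIV. N \<alpha> \<mu> x * frechet_derivative (dy \<alpha> f) (at x) v
          + frechet_derivative (N \<alpha> \<mu>) (at x) v * dy \<alpha> f x))"
    unfolding delta_def[abs_def]
    by (rule sym, rule frechet_derivative_at)
      (intro has_derivative_diff has_derivative_sum has_derivative_mult works)
  then show "dx \<sigma> (delta N \<mu> f) x = dx \<sigma> (dx \<mu> f) x
      - (\<Sum>\<alpha>\<in>UNIV. N \<alpha> \<mu> x * dx \<sigma> (dy \<alpha> f) x + dx \<sigma> (N \<alpha> \<mu>) x * dy \<alpha> f x)"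
    "dy \<sigma> (delta N \<mu> f) x = dy \<sigma> (dx \<mu> f) x
      - (\<Sum>\<alpha>\<in>UNIV. N \<alpha> \<mu> x * dy \<sigma> (dy \<alpha> f) x + dy \<sigma> (N \<alpha> \<mu>) x * dy \<alpha> f x)"
    by (simp_all add: dx_def[of \<sigma>] dy_def[of \<sigma>])
qed

text \<open>Whatever is symmetric in \<sigma> and \<mu> drops out: the pure x-derivatives, the two
  mixed sums, which trade places, and the double sum after renaming. Only terms with a derivative of
  \<open>N\<close> survive, hence first vertical derivatives of \<open>f\<close>.\<close>

lemma delta_commutator:
  assumes S: "open S" and x: "x \<in> S" and f: "twice_differentiable_on f S"
    and N: "\<And>\<alpha> \<mu>. N \<alpha> \<mu> differentiable (at x)"
  shows "delta N \<sigma> (delta N \<mu> f) x - delta N \<mu> (delta N \<sigma> f) x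
    = (\<Sum>\<epsilon>\<in>UNIV. nl_curvature N \<epsilon> \<sigma> \<mu> x * dy \<epsilon> f x)"
proof -
  have second: "delta N \<sigma> (delta N \<mu> f) x = dx \<sigma> (dx \<mu> f) x
      - (\<Sum>\<alpha>\<in>UNIV. N \<alpha> \<mu> x * dx \<sigma> (dy \<alpha> f) x) - (\<Sum>\<beta>\<in>UNIV. N \<beta> \<sigma> x * dy \<beta> (dx \<mu> f) x)
      + (\<Sum>\<beta>\<in>UNIV. \<Sum>\<alpha>\<in>UNIV. N \<beta> \<sigma> x * N \<alpha> \<mu> x * dy \<beta> (dy \<alpha> f) x)
      - (\<Sum>\<alpha>\<in>UNIV. delta N \<sigma> (N \<alpha> \<mu>) x * dy \<alpha> f x)" for \<sigma> \<mu>
  proof -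
    \<comment> \<open>The x- and y-derivatives that fall on the coefficients recombine into a
      horizontal derivative of \<open>N\<close>, as the curvature of \<open>N\<close>
      requires.\<close>
    have "(\<Sum>\<alpha>\<in>UNIV. delta N \<sigma> (N \<alpha> \<mu>) x * dy \<alpha> f x) = (\<Sum>\<alpha>\<in>UNIV. dx \<sigma> (N \<alpha> \<mu>) x * dy \<alpha> f x)
        - (\<Sum>\<alpha>\<in>UNIV. \<Sum>\<beta>\<in>UNIV. N \<beta> \<sigma> x * (dy \<beta> (N \<alpha> \<mu>) x * dy \<alpha> f x))"
      by (simp add: delta_def left_diff_distrib sum_subtractf sum_distrib_right mult.assoc)
    also have "(\<Sum>\<alpha>\<in>UNIV. \<Sum>\<beta>\<in>UNIV. N \<beta> \<sigma> x * (dy \<beta> (N \<alpha> \<mu>) x * dy \<alpha> f x))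
        = (\<Sum>\<beta>\<in>UNIV. N \<beta> \<sigma> x * (\<Sum>\<alpha>\<in>UNIV. dy \<beta> (N \<alpha> \<mu>) x * dy \<alpha> f x))"
      by (subst sum.swap) (simp add: sum_distrib_left)
    finally show ?thesis
      unfolding delta_def[of N \<sigma> "delta N \<mu> f"] partials_delta(2,3)[OF x f N]
      by (simp add: sum.distrib sum_subtractf distrib_left right_diff_distrib sum_distrib_left mult.assoc)
  qed
  have swap: "(\<Sum>\<beta>\<in>UNIV. \<Sum>\<alpha>\<in>UNIV. N \<beta> \<sigma> x * N \<alpha> \<mu> x * dy \<beta> (dy \<alpha> f) x)
      = (\<Sum>\<beta>\<in>UNIV. \<Sum>\<alpha>\<in>UNIV. N \<beta> \<mu> x * N \<alpha> \<sigma> x * dy \<beta> (dy \<alpha> f) x)"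
    by (subst sum.swap)
      (intro sum.cong refl, simp add: partials_commute(3)[OF S x f] mult.commute mult.left_commute)
  show ?thesis
    unfolding second swap nl_curvature_def left_diff_distrib sum_subtractf
    using partials_commute(1)[OF S x f, of \<sigma> \<mu>] by (simp add: partials_commute(2)[OF S x f])
qed

lemma frame_derivation_dy:
  assumes "open S" "\<And>i \<alpha>. twice_differentiable_on (lam i \<alpha>) S"
    "\<And>x. x \<in> S \<Longrightarrow> invertible (\<chi> j \<alpha>. lam j \<alpha> x)"
  shows "frame_derivation S lam dy (\<lambda>_ _ _ _. 0)"
proof
  show "dy \<mu> f x = dy \<mu> g x"
    if "x \<in> S" "f differentiable (at x)" "\<And>y. y \<in> S \<Longrightarrow> f y = g y" for \<mu> f g x
    by (rule partials_cong(2)[OF assms(1) that])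
  show "dy \<sigma> (dy \<mu> f) x - dy \<mu> (dy \<sigma> f) x = (\<Sum>\<epsilon>\<in>UNIV. 0 * dy \<epsilon> f x)"
    if "x \<in> S" "twice_differentiable_on f S" for \<sigma> \<mu> f x
    using partials_commute(3)[OF assms(1) that] by simp
qed (use assms in \<open>simp_all add: partials_const partials_add partials_mult partials_differentiable\<close>)

lemma frame_derivation_delta:
  assumes "open S" "\<And>i \<alpha>. twice_differentiable_on (lam i \<alpha>) S"
    "\<And>x. x \<in> S \<Longrightarrow> invertible (\<chi> j \<alpha>. lam j \<alpha> x)"
    and N: "\<And>x \<alpha> \<mu>. x \<in> S \<Longrightarrow> N \<alpha> \<mu> differentiable (at x)"
  shows "frame_derivation S lam (delta N) (nl_curvature N)"
proof
  show "delta N \<mu> f x = delta N \<mu> g x"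
    if "x \<in> S" "f differentiable (at x)" "\<And>y. y \<in> S \<Longrightarrow> f y = g y" for \<mu> f g x
    using partials_cong[OF assms(1) that] by (simp add: delta_def)
  show "nl_curvature N \<epsilon> \<sigma> \<mu> x = - nl_curvature N \<epsilon> \<mu> \<sigma> x" for \<epsilon> \<sigma> \<mu> x
    by (simp add: nl_curvature_def)
qed (use assms in \<open>simp_all add: delta_add delta_mult partials_delta(1) delta_commutator\<close>,
  simp add: delta_def partials_const)

section \<open>Induced charts of a GAP-space and assembly of the six formulas\<close>

lemma gap_space_chart:
  fixes a :: "('m, 'n::finite) chart"
  assumes gap: "gap_space X A lam" and a: "a \<in> A"
  shows "open (tm_range a)" "twice_differentiable_on (lam a i \<alpha>) (tm_range a)"
    "x \<in> tm_range a \<Longrightarrow> invertible (\<chi> j \<alpha>. lam a j \<alpha> x)"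
proof -
  show S: "open (tm_range a)"
    using gap a by (auto simp: gap_space_def smooth_manifold_def is_chart_def tm_range_def
        intro!: open_Times)
  show "twice_differentiable_on (lam a i \<alpha>) (tm_range a)"
    using gap a by (intro smooth_imp_twice_differentiable_on[OF _ S])
      (auto simp: gap_space_def pullback_section_def)
  show "invertible (\<chi> j \<alpha>. lam a j \<alpha> x)" if "x \<in> tm_range a"
    unfolding invertible_right_inverse matrix_right_invertible_independent_rows
    using gap a that by (simp add: gap_space_def vec_eq_iff row_def)
qed

theorem proposition6p2:
  fixes X :: "'m topology" and A :: "('m, 'n::finite) chart set"
    and lam N :: "('m, 'n) chart \<Rightarrow> 'n \<Rightarrow> 'n \<Rightarrow> 'n field"
    and a :: "('m, 'n) chart" and z :: "'n point" and \<mu> \<sigma> :: 'n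
  assumes gap: "gap_space X A lam"
    and nlc: "nonlinear_connection A N"
    and chart: "a \<in> A" "z \<in> tm_range a"
    and curv: "R = nl_curvature (N a)"
    and canonical: "\<Gamma> = canonical_h (N a) (lam a)" "C = canonical_v (lam a)"
    and riemannian: "\<Gamma>0 = riemannian_h (N a) (lam a)" "C0 = riemannian_v (lam a)"
    and tensors: "\<Lambda> = torsion \<Gamma>" "T = torsion C"
      "\<gamma> = contortion \<Gamma> \<Gamma>0" "G = contortion C C0"
      "\<beta> = contracted_torsion \<Lambda>" "B = contracted_torsion T"
      "L = L_tensor (N a) C"
    and h_ricci:
      "Rdual = ricci (h_curvature (N a) (dual_coeff \<Gamma>) (dual_coeff C))"
      "Rsym = ricci (h_curvature (N a) (sym_coeff \<Gamma>) (sym_coeff C))"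
      "Rriem = ricci (h_curvature (N a) \<Gamma>0 C0)"
    and v_ricci:
      "Sdual = ricci (v_curvature (dual_coeff C))"
      "Ssym = ricci (v_curvature (sym_coeff C))"
      "Sriem = ricci (v_curvature C0)"
    and h_deriv: "h_cov_01 = cov_01 (delta (N a)) \<Gamma>" "h_cov_12 = cov_12 (delta (N a)) \<Gamma>"
    and v_deriv: "v_cov_01 = cov_01 dy C" "v_cov_12 = cov_12 dy C"
  shows
    "Rdual \<mu> \<sigma> z = h_cov_01 \<beta> \<sigma> \<mu> z + (\<Sum>\<alpha>\<in>UNIV. \<Sum>\<epsilon>\<in>UNIV. C \<alpha> \<epsilon> \<mu> z * R \<epsilon> \<sigma> \<alpha> z)
       + (\<Sum>\<alpha>\<in>UNIV. L \<alpha> \<sigma> \<alpha> \<mu> z) + (\<Sum>\<alpha>\<in>UNIV. L \<alpha> \<alpha> \<mu> \<sigma> z)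
     \<and> Sdual \<mu> \<sigma> z = v_cov_01 B \<sigma> \<mu> z
     \<and> Rsym \<mu> \<sigma> z = 1/2 * Rdual \<mu> \<sigma> z
         + 1/4 * ((\<Sum>\<epsilon>\<in>UNIV. \<beta> \<epsilon> z * \<Lambda> \<epsilon> \<sigma> \<mu> z)
                + (\<Sum>\<epsilon>\<in>UNIV. \<Sum>\<alpha>\<in>UNIV. \<Lambda> \<epsilon> \<alpha> \<sigma> z * \<Lambda> \<alpha> \<mu> \<epsilon> z))
     \<and> Ssym \<mu> \<sigma> z = 1/2 * Sdual \<mu> \<sigma> z
         + 1/4 * ((\<Sum>\<epsilon>\<in>UNIV. B \<epsilon> z * T \<epsilon> \<sigma> \<mu> z)
                + (\<Sum>\<epsilon>\<in>UNIV. \<Sum>\<alpha>\<in>UNIV. T \<epsilon> \<alpha> \<sigma> z * T \<alpha> \<mu> \<epsilon> z))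
     \<and> Rriem \<mu> \<sigma> z = h_cov_01 \<beta> \<mu> \<sigma> z - (\<Sum>\<alpha>\<in>UNIV. h_cov_12 \<gamma> \<alpha> \<mu> \<sigma> \<alpha> z)
         + (\<Sum>\<epsilon>\<in>UNIV. \<beta> \<epsilon> z * \<gamma> \<epsilon> \<mu> \<sigma> z)
         - (\<Sum>\<alpha>\<in>UNIV. \<Sum>\<epsilon>\<in>UNIV. \<gamma> \<alpha> \<mu> \<epsilon> z * \<gamma> \<epsilon> \<sigma> \<alpha> z)
         + (\<Sum>\<alpha>\<in>UNIV. \<Sum>\<epsilon>\<in>UNIV. G \<alpha> \<mu> \<epsilon> z * R \<epsilon> \<alpha> \<sigma> z)
     \<and> Sriem \<mu> \<sigma> z = v_cov_01 B \<mu> \<sigma> z - (\<Sum>\<alpha>\<in>UNIV. v_cov_12 G \<alpha> \<mu> \<sigma> \<alpha> z)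
         + (\<Sum>\<epsilon>\<in>UNIV. B \<epsilon> z * G \<epsilon> \<mu> \<sigma> z)
         - (\<Sum>\<alpha>\<in>UNIV. \<Sum>\<epsilon>\<in>UNIV. G \<alpha> \<mu> \<epsilon> z * G \<epsilon> \<sigma> \<alpha> z)"
proof -
  let ?S = "tm_range a"
  note chart_S = gap_space_chart[OF gap chart(1)]
  have "N a \<alpha> \<mu> differentiable (at x)" if "x \<in> ?S" for \<alpha> \<mu> x
    using nlc chart(1) smooth_imp_twice_differentiable_on[OF _ chart_S(1)] that
    by (simp add: nonlinear_connection_def twice_differentiable_on_def)
  then interpret h: frame_derivation ?S "lam a" "delta (N a)" "nl_curvature (N a)"
    by (intro frame_derivation_delta chart_S)
  interpret v: frame_derivation ?S "lam a" dy "\<lambda>_ _ _ _. 0"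
    by (intro frame_derivation_dy chart_S)
  have \<Gamma>: "h.conn = \<Gamma>" and C: "v.conn = C" and \<Gamma>0: "h.levi_civita = \<Gamma>0" and C0: "v.levi_civita = C0"
    unfolding canonical riemannian
    by (intro ext; simp only: h.conn_def v.conn_def h.levi_civita_def v.levi_civita_def
        canonical_h_def canonical_v_def riemannian_h_def riemannian_v_def)+
  note eqs = \<Gamma> C \<Gamma>0 C0 canonical(2)[symmetric] curv[symmetric] tensors[symmetric]
    h_deriv[symmetric] v_deriv[symmetric]
  \<comment> \<open>\<open>Q'\<close> becomes the C R term of the dual connection in the second fact
    and that of the Riemannian connection in the third.\<close>
  note h = h.ricci_dual[OF chart(2), unfolded eqs]
    h.ricci_sym[OF chart(2), unfolded eqs,
      where Q' = "\<lambda>\<alpha> \<mu> \<sigma> \<rho>. \<Sum>\<epsilon>\<in>UNIV. dual_coeff C \<alpha> \<mu> \<epsilon> z * R \<epsilon> \<sigma> \<rho> z"]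
    h.ricci_levi_civita[OF chart(2), unfolded eqs,
      where Q' = "\<lambda>\<alpha> \<mu> \<sigma> \<rho>. \<Sum>\<epsilon>\<in>UNIV. C0 \<alpha> \<mu> \<epsilon> z * R \<epsilon> \<sigma> \<rho> z"]
  \<comment> \<open>A v-curvature has no C R term, so both \<open>K\<close> and \<open>Q'\<close>
    are zero.\<close>
  note v = v.ricci_dual[OF chart(2), unfolded eqs]
    v.ricci_sym[OF chart(2), unfolded eqs, where Q' = "\<lambda>_ _ _ _. 0"]
    v.ricci_levi_civita[OF chart(2), unfolded eqs, where Q' = "\<lambda>_ _ _ _. 0"]
  have R: "R \<epsilon> \<sigma> \<alpha> z = - R \<epsilon> \<alpha> \<sigma> z" for \<epsilon> \<sigma> \<alpha>
    by (simp add: curv nl_curvature_def)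
  \<comment> \<open>The curvature carries R^\<epsilon>_{\<sigma>\<alpha>}, the claim
    R^\<epsilon>_{\<alpha>\<sigma>}; antisymmetry of R turns the subtracted difference of C R terms
    into the positive G R term.\<close>
  have G: "(\<Sum>\<epsilon>\<in>UNIV. G \<alpha> \<mu> \<epsilon> z * R \<epsilon> \<alpha> \<sigma> z) = - ((\<Sum>\<epsilon>\<in>UNIV. C \<alpha> \<mu> \<epsilon> z * R \<epsilon> \<sigma> \<alpha> z)
      - (\<Sum>\<epsilon>\<in>UNIV. C0 \<alpha> \<mu> \<epsilon> z * R \<epsilon> \<sigma> \<alpha> z))" for \<alpha>
    unfolding R[of _ \<sigma>] by (simp add: tensors contortion_def left_diff_distrib sum_subtractf sum_negf)
  \<comment> \<open>The term missing from \<open>ricci_dual\<close> is the second summand, with the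
    lower indices of \<open>C\<close> interchanged by dualisation; the two sums with
    \<open>K\<close> are the contractions of \<open>L\<close>.\<close>
  have a: "Rdual \<mu> \<sigma> z = h_cov_01 \<beta> \<sigma> \<mu> z + (\<Sum>\<alpha>\<in>UNIV. \<Sum>\<epsilon>\<in>UNIV. C \<alpha> \<epsilon> \<mu> z * R \<epsilon> \<sigma> \<alpha> z)
       + (\<Sum>\<alpha>\<in>UNIV. L \<alpha> \<sigma> \<alpha> \<mu> z) + (\<Sum>\<alpha>\<in>UNIV. L \<alpha> \<alpha> \<mu> \<sigma> z)"
    using h(1)[of \<mu> \<sigma>]
    by (simp add: h_ricci(1) ricci_def h_curvature_def dual_coeff_def[of C] tensors(7) L_tensor_def
        curv[symmetric] sum.distrib)
  have b: "Sdual \<mu> \<sigma> z = v_cov_01 B \<sigma> \<mu> z"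
    using v(1)[of \<mu> \<sigma>] by (simp add: v_ricci(1) ricci_def v_curvature_def)
  \<comment> \<open>This brings the C R term of the symmetric connection into the form of a mean
    that \<open>ricci_sym\<close> expects.\<close>
  have "(\<Sum>\<epsilon>\<in>UNIV. sym_coeff C \<alpha> \<mu> \<epsilon> z * R \<epsilon> \<sigma> \<rho> z) = 1/2 * ((\<Sum>\<epsilon>\<in>UNIV. C \<alpha> \<mu> \<epsilon> z * R \<epsilon> \<sigma> \<rho> z)
      + (\<Sum>\<epsilon>\<in>UNIV. dual_coeff C \<alpha> \<mu> \<epsilon> z * R \<epsilon> \<sigma> \<rho> z))" for \<alpha> \<rho>
    unfolding sum.distrib[symmetric] sum_distrib_left
    by (simp add: sym_coeff_def dual_coeff_def algebra_simps)
  then have c: "Rsym \<mu> \<sigma> z = 1/2 * Rdual \<mu> \<sigma> z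
         + 1/4 * ((\<Sum>\<epsilon>\<in>UNIV. \<beta> \<epsilon> z * \<Lambda> \<epsilon> \<sigma> \<mu> z)
                + (\<Sum>\<epsilon>\<in>UNIV. \<Sum>\<alpha>\<in>UNIV. \<Lambda> \<epsilon> \<alpha> \<sigma> z * \<Lambda> \<alpha> \<mu> \<epsilon> z))"
    using h(2)[of \<mu> \<sigma>] by (simp only: h_ricci ricci_def h_curvature_def curv[symmetric])
  have d: "Ssym \<mu> \<sigma> z = 1/2 * Sdual \<mu> \<sigma> z
         + 1/4 * ((\<Sum>\<epsilon>\<in>UNIV. B \<epsilon> z * T \<epsilon> \<sigma> \<mu> z)
                + (\<Sum>\<epsilon>\<in>UNIV. \<Sum>\<alpha>\<in>UNIV. T \<epsilon> \<alpha> \<sigma> z * T \<alpha> \<mu> \<epsilon> z))"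
    using v(2)[of \<mu> \<sigma>] by (simp add: v_ricci ricci_def v_curvature_def)
  have e: "Rriem \<mu> \<sigma> z = h_cov_01 \<beta> \<mu> \<sigma> z - (\<Sum>\<alpha>\<in>UNIV. h_cov_12 \<gamma> \<alpha> \<mu> \<sigma> \<alpha> z)
         + (\<Sum>\<epsilon>\<in>UNIV. \<beta> \<epsilon> z * \<gamma> \<epsilon> \<mu> \<sigma> z)
         - (\<Sum>\<alpha>\<in>UNIV. \<Sum>\<epsilon>\<in>UNIV. \<gamma> \<alpha> \<mu> \<epsilon> z * \<gamma> \<epsilon> \<sigma> \<alpha> z)
         + (\<Sum>\<alpha>\<in>UNIV. \<Sum>\<epsilon>\<in>UNIV. G \<alpha> \<mu> \<epsilon> z * R \<epsilon> \<alpha> \<sigma> z)"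
    using h(3)[of \<mu> \<sigma>]
    unfolding G sum_negf h_ricci ricci_def h_curvature_def curv[symmetric] by simp
  have f: "Sriem \<mu> \<sigma> z = v_cov_01 B \<mu> \<sigma> z - (\<Sum>\<alpha>\<in>UNIV. v_cov_12 G \<alpha> \<mu> \<sigma> \<alpha> z)
         + (\<Sum>\<epsilon>\<in>UNIV. B \<epsilon> z * G \<epsilon> \<mu> \<sigma> z)
         - (\<Sum>\<alpha>\<in>UNIV. \<Sum>\<epsilon>\<in>UNIV. G \<alpha> \<mu> \<epsilon> z * G \<epsilon> \<sigma> \<alpha> z)"
    using v(3)[of \<mu> \<sigma>] by (simp add: v_ricci ricci_def v_curvature_def)
  from a b c d e f show ?thesis by blast
qed

end
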